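(* Let $(Q,\mathcal F_Q,\mathbb M)$ be a standard Borel space with a nonatomic probability measure, let $\mathcal H=L^2(Q,\mathbb M;\mathbb R)$ (i.e. $H=\mathbb R$), and let $\iota:\mathcal H\to\mathcal P_2(\mathbb R)$, $\iota(X):=X_\sharp\mathbb M$. If $\mathfrak g$ is a nondegenerate Gaussian measure in $\mathcal H$, then $\mathtt G:=\iota_\sharp\mathfrak g\in\mathcal P_2(\mathcal P_2(\mathbb R))$ is super-G-regular.
   Context: $\mathcal P_2(\mathbb R)$: Borel probability measures on $\mathbb R$ with finite quadratic moment, with 2-Wasserstein metric; $\mathcal P_2(\mathcal P_2(\mathbb R))$: Borel probability measures on it with finite quadratic moment. $\mathcal P_2^r(\mathbb R)$: the atomless measures in $\mathcal P_2(\mathbb R)$. A Gaussian measure on a separable Hilbert space is nondegenerate if every nonzero continuous linear functional has a Gaussian law with positive variance; a Borel set is Gaussian-null if it is negligible for every nondegenerate Gaussian measure. $\mathtt M\in\mathcal P_2(\mathcal P_2(\mathbb R))$ is super-G-regular if (i) $\mathtt M$ is concentrated on $\mathcal P_2^r(\mathbb R)$ and (ii) $\mathtt M(B)=0$ for every Borel $B\subset\mathcal P_2(\mathbb R)$ such that $\iota^{-1}(B)$ is Gaussian-null in $\mathcal H$. *)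

theory Defs
  imports "HOL-Probability.Probability"
begin

section \<open>Topologies from distances, Borel sets, standard Borel and atomless measures\<close>

(* The metric topology on S. It is the library's Metric_space.mtopology (see the lemma below), but
   the defining equation of the latter is only available once the metric axioms have been proved. *)
definition metric_topology :: "'a set \<Rightarrow> ('a \<Rightarrow> 'a \<Rightarrow> real) \<Rightarrow> 'a topology" where
  "metric_topology S d =
     topology (\<lambda>U. U \<subseteq> S \<and> (\<forall>x\<in>U. \<exists>r>0. \<forall>y\<in>S. d x y < r \<longrightarrow> y \<in> U))"

lemma metric_topology_eq_mtopology:
  assumes "Metric_space S d"
  shows "metric_topology S d = Metric_space.mtopology S d"
proof -
  interpret Metric_space S d by fact
  have "(\<lambda>U. U \<subseteq> S \<and> (\<forall>x\<in>U. \<exists>r>0. \<forall>y\<in>S. d x y < r \<longrightarrow> y \<in> U)) = mopen"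
    unfolding mopen_def by (intro ext) (fastforce simp: subset_iff)
  then show ?thesis
    by (simp add: metric_topology_def mtopology_def)
qed

definition borel_of :: "'a topology \<Rightarrow> 'a measure" where
  "borel_of T = sigma (topspace T) {U. openin T U}"

definition standard_borel :: "'a measure \<Rightarrow> bool" where
  "standard_borel M \<longleftrightarrow>
     (\<exists>T. completely_metrizable_space T \<and> second_countable T \<and>
          topspace T = space M \<and> sets M = sets (borel_of T))"

definition is_atom :: "'a measure \<Rightarrow> 'a set \<Rightarrow> bool" where
  "is_atom M A \<longleftrightarrow>
     A \<in> sets M \<and> 0 < emeasure M A \<and>
     (\<forall>B\<in>sets M. B \<subseteq> A \<longrightarrow> emeasure M B = 0 \<or> emeasure M B = emeasure M A)"

definition atomless :: "'a measure \<Rightarrow> bool" where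
  "atomless M \<longleftrightarrow> (\<nexists>A. is_atom M A)"


section \<open>The Wasserstein space over the reals and measures on it\<close>

definition P2 :: "real measure set" where
  "P2 = {\<mu>. sets \<mu> = sets borel \<and> prob_space \<mu> \<and> (\<integral>\<^sup>+ x. ennreal (x\<^sup>2) \<partial>\<mu>) < \<infinity>}"

definition P2_regular :: "real measure set" where
  "P2_regular = {\<mu> \<in> P2. atomless \<mu>}"

definition couplings :: "real measure \<Rightarrow> real measure \<Rightarrow> (real \<times> real) measure set" where
  "couplings \<mu> \<nu> =
     {\<gamma>. sets \<gamma> = sets borel \<and> distr \<gamma> borel fst = \<mu> \<and> distr \<gamma> borel snd = \<nu>}"

definition W2 :: "real measure \<Rightarrow> real measure \<Rightarrow> real" where
  "W2 \<mu> \<nu> =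
     sqrt (enn2real (INF \<gamma>\<in>couplings \<mu> \<nu>. \<integral>\<^sup>+ z. ennreal ((fst z - snd z)\<^sup>2) \<partial>\<gamma>))"

definition borel_P2 :: "real measure measure" where
  "borel_P2 = borel_of (metric_topology P2 W2)"

definition P2P2 :: "real measure measure set" where
  "P2P2 = {\<GG>. sets \<GG> = sets borel_P2 \<and> prob_space \<GG> \<and>
                (\<exists>\<nu>\<in>P2. (\<integral>\<^sup>+ \<mu>. ennreal ((W2 \<mu> \<nu>)\<^sup>2) \<partial>\<GG>) < \<infinity>)}"


section \<open>The Hilbert space of square-integrable real functions\<close>

definition sq_integrable :: "'q measure \<Rightarrow> ('q \<Rightarrow> real) set" where
  "sq_integrable M = {f \<in> borel_measurable M. integrable M (\<lambda>q. (f q)\<^sup>2)}"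

definition L2_class :: "'q measure \<Rightarrow> ('q \<Rightarrow> real) \<Rightarrow> ('q \<Rightarrow> real) set" where
  "L2_class M f = {g \<in> sq_integrable M. AE q in M. g q = f q}"

definition L2 :: "'q measure \<Rightarrow> ('q \<Rightarrow> real) set set" where
  "L2 M = L2_class M ` sq_integrable M"

(* An arbitrary representative; nothing below depends on the choice. *)
definition rep :: "('q \<Rightarrow> real) set \<Rightarrow> 'q \<Rightarrow> real" where
  "rep u = (SOME f. f \<in> u)"

definition L2_add :: "'q measure \<Rightarrow> ('q \<Rightarrow> real) set \<Rightarrow> ('q \<Rightarrow> real) set \<Rightarrow> ('q \<Rightarrow> real) set" where
  "L2_add M u v = L2_class M (\<lambda>q. rep u q + rep v q)"

definition L2_scale :: "'q measure \<Rightarrow> real \<Rightarrow> ('q \<Rightarrow> real) set \<Rightarrow> ('q \<Rightarrow> real) set" where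
  "L2_scale M c u = L2_class M (\<lambda>q. c * rep u q)"

definition L2_dist :: "'q measure \<Rightarrow> ('q \<Rightarrow> real) set \<Rightarrow> ('q \<Rightarrow> real) set \<Rightarrow> real" where
  "L2_dist M u v = sqrt (\<integral>q. (rep u q - rep v q)\<^sup>2 \<partial>M)"

definition L2_topology :: "'q measure \<Rightarrow> ('q \<Rightarrow> real) set topology" where
  "L2_topology M = metric_topology (L2 M) (L2_dist M)"

definition borel_L2 :: "'q measure \<Rightarrow> ('q \<Rightarrow> real) set measure" where
  "borel_L2 M = borel_of (L2_topology M)"

definition L2_functional :: "'q measure \<Rightarrow> (('q \<Rightarrow> real) set \<Rightarrow> real) \<Rightarrow> bool" where
  "L2_functional M \<phi> \<longleftrightarrow>
     continuous_map (L2_topology M) euclideanreal \<phi> \<and>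
     (\<forall>u\<in>L2 M. \<forall>v\<in>L2 M. \<phi> (L2_add M u v) = \<phi> u + \<phi> v) \<and>
     (\<forall>c. \<forall>u\<in>L2 M. \<phi> (L2_scale M c u) = c * \<phi> u)"


section \<open>Gaussian measures, Gaussian-null sets and super-G-regularity\<close>

(* The Gaussian laws may have any mean m; sigma is the standard deviation. *)
definition nondegenerate_gaussian :: "'q measure \<Rightarrow> ('q \<Rightarrow> real) set measure \<Rightarrow> bool" where
  "nondegenerate_gaussian M g \<longleftrightarrow>
     sets g = sets (borel_L2 M) \<and> prob_space g \<and>
     (\<forall>\<phi>. L2_functional M \<phi> \<and> (\<exists>u\<in>L2 M. \<phi> u \<noteq> 0) \<longrightarrow>
        (\<exists>m \<sigma>. 0 < \<sigma> \<and> distributed g lborel \<phi> (normal_density m \<sigma>)))"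

definition gaussian_null :: "'q measure \<Rightarrow> ('q \<Rightarrow> real) set set \<Rightarrow> bool" where
  "gaussian_null M A \<longleftrightarrow>
     A \<in> sets (borel_L2 M) \<and> (\<forall>g. nondegenerate_gaussian M g \<longrightarrow> emeasure g A = 0)"

definition iota :: "'q measure \<Rightarrow> ('q \<Rightarrow> real) set \<Rightarrow> real measure" where
  "iota M u = distr M borel (rep u)"

definition super_G_regular :: "'q measure \<Rightarrow> real measure measure \<Rightarrow> bool" where
  "super_G_regular M \<GG> \<longleftrightarrow>
     \<GG> \<in> P2P2 \<and>
     (AE \<mu> in \<GG>. \<mu> \<in> P2_regular) \<and>
     (\<forall>B\<in>sets borel_P2. gaussian_null M (iota M -` B \<inter> L2 M) \<longrightarrow> emeasure \<GG> B = 0)"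

end

theory Submission
  imports Defs
begin

text \<open>Let \<open>g\<close> be a nondegenerate Gaussian measure on \<open>L\<^sup>2(Q, M)\<close>. The law map is 1-Lipschitz, since
  the joint law of \<open>X\<close> and \<open>Y\<close> couples their laws; so the image of \<open>g\<close> is a Borel measure, and it charges no set whose
  preimage is Gaussian-null.

  \<^emph>\<open>Second moment.\<close> The squared norms \<open>S\<^sub>N\<close> of the averages of \<open>X\<close> over the cells of finer and finer finite
  partitions are sums of squares of Gaussian variables, hence \<open>E S\<^sub>N\<^sup>2 \<le> 24 (E S\<^sub>N)\<^sup>2\<close>. As \<open>S\<^sub>N\<close> converges to
  the finite quantity \<open>\<parallel>X\<parallel>\<^sup>2\<close>, a Paley--Zygmund argument bounds \<open>E S\<^sub>N\<close>, and Fatou gives \<open>E \<parallel>X\<parallel>\<^sup>2 < \<infinity>\<close>.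

  \<^emph>\<open>No atoms.\<close> A law \<open>\<mu>\<close> has an atom only if \<open>\<mu> \<otimes> \<mu>\<close> charges the diagonal. The averages of \<open>X\<close> over the cells
  of \<open>q\<close> and \<open>q'\<close> differ by a Gaussian variable which is within \<open>1/n\<close> of zero with probability at most
  \<open>8/(n s)\<close>, where \<open>s\<close> is its \<open>L\<^sup>2(g)\<close>-norm. Along a subsequence these norms converge for almost all
  \<open>(q, q')\<close>, and the limit is positive: if it vanished for \<open>q\<close> in a set of positive measure, a mean-zero
  function supported there would define a functional vanishing \<open>g\<close>-almost surely. Thus the expected mass
  that \<open>\<mu> \<otimes> \<mu>\<close> gives to the \<open>1/n\<close>-neighbourhood of the diagonal tends to zero.\<close>

subsection \<open>Square-integrable functions\<close>

lemma sq_integrableD: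
  assumes "f \<in> sq_integrable M"
  shows "f \<in> borel_measurable M" "integrable M (\<lambda>x. (f x)\<^sup>2)"
  using assms by (auto simp: sq_integrable_def)

lemma integrable_mult_sq:
  assumes "f \<in> sq_integrable M" "h \<in> sq_integrable M"
  shows "integrable M (\<lambda>x. f x * h x)"
proof (rule Bochner_Integration.integrable_bound)
  note [measurable] = sq_integrableD(1)[OF assms(1)] sq_integrableD(1)[OF assms(2)]
  show "integrable M (\<lambda>x. (f x)\<^sup>2 + (h x)\<^sup>2)"
    using assms by (auto simp: sq_integrable_def)
  show "(\<lambda>x. f x * h x) \<in> borel_measurable M" by measurable
  show "AE x in M. norm (f x * h x) \<le> norm ((f x)\<^sup>2 + (h x)\<^sup>2)"
  proof (rule AE_I2)
    fix x
    have "2 * (\<bar>f x\<bar> * \<bar>h x\<bar>) \<le> (f x)\<^sup>2 + (h x)\<^sup>2"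
      using sum_squares_bound[of "\<bar>f x\<bar>" "\<bar>h x\<bar>"] by simp
    moreover have "0 \<le> \<bar>f x\<bar> * \<bar>h x\<bar>" by simp
    ultimately have "\<bar>f x\<bar> * \<bar>h x\<bar> \<le> (f x)\<^sup>2 + (h x)\<^sup>2" by linarith
    then show "norm (f x * h x) \<le> norm ((f x)\<^sup>2 + (h x)\<^sup>2)"
      by (simp add: abs_mult)
  qed
qed

lemma sq_integrable_add:
  assumes "f \<in> sq_integrable M" "h \<in> sq_integrable M"
  shows "(\<lambda>x. f x + h x) \<in> sq_integrable M"
  using sq_integrableD[OF assms(1)] sq_integrableD[OF assms(2)] integrable_mult_sq[OF assms]
  by (simp add: sq_integrable_def power2_sum mult.assoc)

lemma sq_integrable_scale:
  assumes "f \<in> sq_integrable M"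
  shows "(\<lambda>x. c * f x) \<in> sq_integrable M"
  using sq_integrableD[OF assms] by (simp add: sq_integrable_def power_mult_distrib)

lemma sq_integrable_diff:
  assumes "f \<in> sq_integrable M" "h \<in> sq_integrable M"
  shows "(\<lambda>x. f x - h x) \<in> sq_integrable M"
  using sq_integrable_add[OF assms(1) sq_integrable_scale[OF assms(2), of "-1"]] by simp

lemma sq_integrable_sum:
  assumes "\<And>i. i \<in> I \<Longrightarrow> f i \<in> sq_integrable M"
  shows "(\<lambda>x. \<Sum>i\<in>I. f i x) \<in> sq_integrable M"
  using assms
proof (induction I rule: infinite_finite_induct)
  case (insert i I)
  then show ?case by (simp add: sq_integrable_add)
qed (auto simp: sq_integrable_def)

lemma sq_integrable_abs:
  "f \<in> sq_integrable M \<Longrightarrow> (\<lambda>x. \<bar>f x\<bar>) \<in> sq_integrable M"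
  by (auto simp: sq_integrable_def)

lemma sq_integrable_dominated:
  assumes "h \<in> sq_integrable M" "f \<in> borel_measurable M" "\<And>x. x \<in> space M \<Longrightarrow> \<bar>f x\<bar> \<le> \<bar>h x\<bar>"
  shows "f \<in> sq_integrable M"
proof -
  note [measurable] = assms(2)
  have "integrable M (\<lambda>x. (f x)\<^sup>2)"
    using sq_integrableD(2)[OF assms(1)]
    by (rule Bochner_Integration.integrable_bound)
      (use assms(3) in \<open>auto simp: abs_le_square_iff[symmetric] intro!: AE_I2\<close>)
  then show ?thesis using assms(2) by (simp add: sq_integrable_def)
qed

lemma (in finite_measure) sq_integrable_bounded:
  assumes "f \<in> borel_measurable M" "\<And>x. x \<in> space M \<Longrightarrow> \<bar>f x\<bar> \<le> B"
  shows "f \<in> sq_integrable M"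
proof -
  note [measurable] = assms(1)
  have "integrable M (\<lambda>x. (f x)\<^sup>2)"
  proof (rule integrable_const_bound[where B = "B\<^sup>2"])
    show "AE x in M. norm ((f x)\<^sup>2) \<le> B\<^sup>2"
      using assms(2) by (intro AE_I2) (fastforce simp: abs_le_square_iff[symmetric])
  qed simp
  then show ?thesis by (simp add: sq_integrable_def)
qed

lemma (in finite_measure) sq_integrable_integrable:
  "f \<in> sq_integrable M \<Longrightarrow> integrable M f"
  unfolding sq_integrable_def by (blast intro: square_integrable_imp_integrable)

text \<open>The integral of \<open>(s * f x - t * h x)\<^sup>2\<close> is a nonnegative quadratic
  form in \<open>s\<close> and \<open>t\<close>; well-chosen values of \<open>s\<close> and
  \<open>t\<close> give the inequality.\<close>

lemma integral_Cauchy_Schwarz: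
  assumes "f \<in> sq_integrable M" "h \<in> sq_integrable M"
  shows "(\<integral>x. f x * h x \<partial>M)\<^sup>2 \<le> (\<integral>x. (f x)\<^sup>2 \<partial>M) * (\<integral>x. (h x)\<^sup>2 \<partial>M)"
proof -
  define a b c where "a = (\<integral>x. (f x)\<^sup>2 \<partial>M)" and "b = (\<integral>x. f x * h x \<partial>M)"
    and "c = (\<integral>x. (h x)\<^sup>2 \<partial>M)"
  note fh = integrable_mult_sq[OF assms] sq_integrableD(2)[OF assms(1)] sq_integrableD(2)[OF assms(2)]
  have quad: "0 \<le> s\<^sup>2 * a - 2 * s * t * b + t\<^sup>2 * c" for s t :: real
  proof -
    have "0 \<le> (\<integral>x. (s * f x - t * h x)\<^sup>2 \<partial>M)" by simp
    also have "(\<lambda>x. (s * f x - t * h x)\<^sup>2)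
        = (\<lambda>x. s\<^sup>2 * (f x)\<^sup>2 - 2 * s * t * (f x * h x) + t\<^sup>2 * (h x)\<^sup>2)"
      by (auto simp: power2_eq_square algebra_simps)
    also have "integral\<^sup>L M \<dots> = s\<^sup>2 * a - 2 * s * t * b + t\<^sup>2 * c"
      unfolding a_def b_def c_def using fh by simp
    finally show ?thesis .
  qed
  have ac: "0 \<le> a" "0 \<le> c" by (auto simp: a_def c_def)
  have "b\<^sup>2 \<le> a * c"
  proof (cases "c = 0")
    case False
    with quad[of c b] have "0 \<le> c * (a * c - b\<^sup>2)"
      by (simp add: power2_eq_square algebra_simps)
    with False ac show ?thesis by (simp add: zero_le_mult_iff)
  next
    case True
    show ?thesis
    proof (rule ccontr)
      assume "\<not> b\<^sup>2 \<le> a * c"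
      then have "b \<noteq> 0" using True by auto
      \<comment> \<open>With \<open>c = 0\<close> and \<open>s = 1\<close> the form is affine in
        \<open>t\<close>; this \<open>t\<close> gives it the value \<open>-1\<close>.\<close>
      moreover have "0 \<le> a - 2 * ((a + 1) / (2 * b)) * b"
        using quad[of 1 "(a + 1) / (2 * b)"] True by simp
      ultimately show False by simp
    qed
  qed
  then show ?thesis by (simp add: a_def b_def c_def)
qed

text \<open>A seminorm on functions rather than on classes, so that it serves both on the base space
  and for random variables under \<open>g\<close>. A non-integrable square has integral
  \<open>0\<close> by default, hence the assumptions of membership in \<open>sq_integrable\<close>
  below.\<close>

definition L2norm :: "'a measure \<Rightarrow> ('a \<Rightarrow> real) \<Rightarrow> real" where
  "L2norm M f = sqrt (\<integral>x. (f x)\<^sup>2 \<partial>M)"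

lemma L2norm_nonneg [simp]: "0 \<le> L2norm M f"
  by (simp add: L2norm_def)

lemma L2norm_squared: "(L2norm M f)\<^sup>2 = (\<integral>x. (f x)\<^sup>2 \<partial>M)"
  by (simp add: L2norm_def)

lemma L2norm_minus_commute: "L2norm M (\<lambda>x. f x - h x) = L2norm M (\<lambda>x. h x - f x)"
  by (simp add: L2norm_def power2_commute)

lemma L2norm_mono:
  assumes "h \<in> sq_integrable M" "f \<in> borel_measurable M" "\<And>x. x \<in> space M \<Longrightarrow> \<bar>f x\<bar> \<le> \<bar>h x\<bar>"
  shows "L2norm M f \<le> L2norm M h"
  unfolding L2norm_def
  using sq_integrableD(2)[OF assms(1)] sq_integrableD(2)[OF sq_integrable_dominated[OF assms]] assms(3)
  by (intro real_sqrt_le_mono integral_mono) (auto simp: abs_le_square_iff)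

lemma abs_integral_mult_le:
  assumes "f \<in> sq_integrable M" "h \<in> sq_integrable M"
  shows "\<bar>\<integral>x. f x * h x \<partial>M\<bar> \<le> L2norm M f * L2norm M h"
  using real_sqrt_le_mono[OF integral_Cauchy_Schwarz[OF assms]]
  by (simp add: L2norm_def real_sqrt_mult)

lemma L2norm_triangle:
  assumes "f \<in> sq_integrable M" "h \<in> sq_integrable M"
  shows "L2norm M (\<lambda>x. f x + h x) \<le> L2norm M f + L2norm M h"
proof (rule power2_le_imp_le)
  have "(L2norm M (\<lambda>x. f x + h x))\<^sup>2
      = (L2norm M f)\<^sup>2 + (L2norm M h)\<^sup>2 + 2 * (\<integral>x. f x * h x \<partial>M)"
    unfolding L2norm_squared
    using integrable_mult_sq[OF assms] sq_integrableD(2)[OF assms(1)] sq_integrableD(2)[OF assms(2)]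
    by (simp add: power2_sum mult.assoc)
  also have "\<dots> \<le> (L2norm M f + L2norm M h)\<^sup>2"
    using abs_integral_mult_le[OF assms] by (simp add: power2_sum)
  finally show "(L2norm M (\<lambda>x. f x + h x))\<^sup>2 \<le> (L2norm M f + L2norm M h)\<^sup>2" .
qed simp

lemma L2norm_scale: "L2norm M (\<lambda>x. c * f x) = \<bar>c\<bar> * L2norm M f"
  by (simp add: L2norm_def power_mult_distrib real_sqrt_mult)

lemma L2norm_sum_le:
  assumes "\<And>i. i \<in> I \<Longrightarrow> f i \<in> sq_integrable M"
  shows "L2norm M (\<lambda>x. \<Sum>i\<in>I. f i x) \<le> (\<Sum>i\<in>I. L2norm M (f i))"
  using assms
proof (induction I rule: infinite_finite_induct)
  case (insert i I)
  have "L2norm M (\<lambda>x. f i x + (\<Sum>i\<in>I. f i x)) \<le> L2norm M (f i) + L2norm M (\<lambda>x. \<Sum>i\<in>I. f i x)"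
    using insert by (intro L2norm_triangle sq_integrable_sum) auto
  then show ?case using insert by fastforce
qed (auto simp: L2norm_def)

lemma L2norm_diff_triangle:
  assumes "f \<in> sq_integrable M" "h \<in> sq_integrable M" "k \<in> sq_integrable M"
  shows "L2norm M (\<lambda>x. f x - k x) \<le> L2norm M (\<lambda>x. f x - h x) + L2norm M (\<lambda>x. h x - k x)"
  using L2norm_triangle[OF sq_integrable_diff[OF assms(1,2)] sq_integrable_diff[OF assms(2,3)]]
  by simp

lemma (in prob_space) integral_abs_le_L2norm:
  assumes "f \<in> sq_integrable M"
  shows "(\<integral>x. \<bar>f x\<bar> \<partial>M) \<le> L2norm M f"
  using abs_integral_mult_le[OF sq_integrable_abs[OF assms], of "\<lambda>_. 1"] prob_space
    sq_integrable_bounded[of "\<lambda>_. 1" 1]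
  by (simp add: L2norm_def)

lemma L2norm_tendsto_0_iff:
  "(\<lambda>n. L2norm M (F n)) \<longlonglongrightarrow> 0 \<longleftrightarrow> (\<lambda>n. \<integral>x. (F n x)\<^sup>2 \<partial>M) \<longlonglongrightarrow> 0"
  using tendsto_real_sqrt[of "\<lambda>n. \<integral>x. (F n x)\<^sup>2 \<partial>M" 0 sequentially]
    tendsto_power[of "\<lambda>n. L2norm M (F n)" 0 sequentially 2]
  by (auto simp: L2norm_def)

subsection \<open>The kernel detecting atoms\<close>

text \<open>A continuous substitute for the indicator of zero: equal to \<open>1\<close> there and,
  for \<open>n > 0\<close>, supported in the \<open>1/n\<close>-neighbourhood. Its Lipschitz bound
  makes the functional of laws built from it continuous for \<open>W2\<close>.\<close>

definition tent :: "nat \<Rightarrow> real \<Rightarrow> real" where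
  "tent n x = max 0 (1 - real n * \<bar>x\<bar>)"

lemma tent_bounds: "0 \<le> tent n x" "tent n x \<le> 1"
  by (auto simp: tent_def)

lemma tent_Lipschitz: "\<bar>tent n x - tent n y\<bar> \<le> real n * \<bar>x - y\<bar>"
proof -
  have "\<bar>tent n x - tent n y\<bar> \<le> \<bar>real n * \<bar>x\<bar> - real n * \<bar>y\<bar>\<bar>"
    unfolding tent_def by linarith
  also have "\<dots> = real n * \<bar>\<bar>x\<bar> - \<bar>y\<bar>\<bar>"
    by (simp add: right_diff_distrib[symmetric] abs_mult)
  also have "\<dots> \<le> real n * \<bar>x - y\<bar>"
    by (intro mult_left_mono) auto
  finally show ?thesis .
qed

lemma tent_le_indicator: "tent n x \<le> indicator {y. real n * \<bar>y\<bar> \<le> 1} x"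
  by (auto simp: tent_def indicator_def)

lemma borel_measurable_tent [measurable]: "tent n \<in> borel_measurable borel"
  unfolding tent_def[abs_def] by measurable

text \<open>For a probability \<open>\<mu>\<close> on the line this decreases, as \<open>n\<close>
  grows, to the mass of the diagonal under \<open>\<mu> \<otimes> \<mu>\<close>, which is the sum of
  the squared masses of the points.\<close>

definition concentration :: "nat \<Rightarrow> real measure \<Rightarrow> real" where
  "concentration n \<mu> = (\<integral>x. \<integral>y. tent n (x - y) \<partial>\<mu> \<partial>\<mu>)"

lemma concentration_distr:
  assumes "prob_space M" and [measurable]: "f \<in> borel_measurable M"
  shows "concentration n (distr M borel f) = (\<integral>q. \<integral>q'. tent n (f q - f q') \<partial>M \<partial>M)"
proof -
  interpret prob_space M by fact
  interpret D: prob_space "distr M borel f" by (rule prob_space_distr) simp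
  have "concentration n (distr M borel f) = (\<integral>q. \<integral>y. tent n (f q - y) \<partial>distr M borel f \<partial>M)"
    unfolding concentration_def
    by (rule integral_distr) measurable
  also have "\<dots> = (\<integral>q. \<integral>q'. tent n (f q - f q') \<partial>M \<partial>M)"
    by (subst integral_distr) simp_all
  finally show ?thesis .
qed

text \<open>With \<open>d = \<bar>f - h\<bar>\<close>, replacing \<open>f\<close> by
  \<open>h\<close> moves the difference at \<open>q\<close> and \<open>q'\<close> by at most
  \<open>d q + d q'\<close>, and \<open>tent n\<close> is \<open>n\<close>-Lipschitz. Integrating
  over both points yields \<open>2 n\<close> times the mean of \<open>d\<close>, which the
  \<open>L2norm\<close> dominates.\<close>

lemma concentration_distr_Lipschitz:
  assumes "prob_space M" and [measurable]: "f \<in> borel_measurable M" "h \<in> borel_measurable M"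
    and sq: "(\<lambda>q. f q - h q) \<in> sq_integrable M"
  shows "\<bar>concentration n (distr M borel f) - concentration n (distr M borel h)\<bar>
      \<le> 2 * real n * L2norm M (\<lambda>q. f q - h q)"
proof -
  interpret prob_space M by fact
  interpret P: pair_prob_space M M ..
  define d where "d q = \<bar>f q - h q\<bar>" for q
  have [measurable]: "d \<in> borel_measurable M" unfolding d_def by measurable
  have d: "integrable M d"
    unfolding d_def using sq_integrable_integrable[OF sq_integrable_abs[OF sq]] .
  have dle: "(\<integral>q. d q \<partial>M) \<le> L2norm M (\<lambda>q. f q - h q)"
    unfolding d_def by (rule integral_abs_le_L2norm[OF sq])
  have bdd: "integrable M (\<lambda>q'. tent n (u q - u q'))"
    if [measurable]: "u \<in> borel_measurable M" for u q
    by (rule integrable_const_bound[where B = 1]) (auto simp: tent_bounds)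
  have bdd2: "integrable M (\<lambda>q. \<integral>q'. tent n (u q - u q') \<partial>M)"
    if [measurable]: "u \<in> borel_measurable M" for u
  proof (rule integrable_const_bound[where B = 1])
    show "AE q in M. norm (\<integral>q'. tent n (u q - u q') \<partial>M) \<le> 1"
      using bdd[OF that] prob_space
      by (intro AE_I2) (auto simp: tent_bounds integral_nonneg intro!: integral_le_const)
  qed measurable
  have "\<bar>concentration n (distr M borel f) - concentration n (distr M borel h)\<bar>
      = \<bar>\<integral>q. ((\<integral>q'. tent n (f q - f q') \<partial>M) - (\<integral>q'. tent n (h q - h q') \<partial>M)) \<partial>M\<bar>"
    using bdd2 by (simp add: concentration_distr[OF assms(1)])
  also have "\<dots> \<le> (\<integral>q. \<bar>(\<integral>q'. tent n (f q - f q') \<partial>M) - (\<integral>q'. tent n (h q - h q') \<partial>M)\<bar> \<partial>M)"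
    by (rule integral_abs_bound)
  also have "\<dots> \<le> (\<integral>q. real n * (d q + (\<integral>q'. d q' \<partial>M)) \<partial>M)"
  proof (rule integral_mono)
    show "integrable M (\<lambda>q. \<bar>(\<integral>q'. tent n (f q - f q') \<partial>M) - (\<integral>q'. tent n (h q - h q') \<partial>M)\<bar>)"
      using bdd2 by simp
    show "integrable M (\<lambda>q. real n * (d q + (\<integral>q'. d q' \<partial>M)))"
      using d by simp
    fix q
    have "\<bar>(\<integral>q'. tent n (f q - f q') \<partial>M) - (\<integral>q'. tent n (h q - h q') \<partial>M)\<bar>
        = \<bar>\<integral>q'. (tent n (f q - f q') - tent n (h q - h q')) \<partial>M\<bar>"
      using bdd by simp
    also have "\<dots> \<le> (\<integral>q'. \<bar>tent n (f q - f q') - tent n (h q - h q')\<bar> \<partial>M)"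
      by (rule integral_abs_bound)
    also have "\<dots> \<le> (\<integral>q'. real n * (d q + d q') \<partial>M)"
    proof (rule integral_mono)
      show "integrable M (\<lambda>q'. \<bar>tent n (f q - f q') - tent n (h q - h q')\<bar>)"
        using bdd by simp
      show "integrable M (\<lambda>q'. real n * (d q + d q'))" using d by simp
      fix q'
      have "\<bar>tent n (f q - f q') - tent n (h q - h q')\<bar> \<le> real n * \<bar>(f q - f q') - (h q - h q')\<bar>"
        by (rule tent_Lipschitz)
      also have "\<dots> \<le> real n * (d q + d q')"
        by (intro mult_left_mono) (auto simp: d_def)
      finally show "\<bar>tent n (f q - f q') - tent n (h q - h q')\<bar> \<le> real n * (d q + d q')" .
    qed
    also have "\<dots> = real n * (d q + (\<integral>q'. d q' \<partial>M))"
      using d prob_space by simp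
    finally show "\<bar>(\<integral>q'. tent n (f q - f q') \<partial>M) - (\<integral>q'. tent n (h q - h q') \<partial>M)\<bar>
        \<le> real n * (d q + (\<integral>q'. d q' \<partial>M))" .
  qed
  also have "\<dots> = 2 * real n * (\<integral>q. d q \<partial>M)"
    using d prob_space by simp
  also have "\<dots> \<le> 2 * real n * L2norm M (\<lambda>q. f q - h q)"
    using dle by (intro mult_left_mono) auto
  finally show ?thesis .
qed

subsection \<open>Topologies of distance functions and their Borel sets\<close>

text \<open>Containing a ball around each of its points is stable under unions and finite
  intersections for an arbitrary \<open>d\<close>, so this description applies directly to
  \<open>W2\<close> and \<open>L2_dist\<close>.\<close>

lemma openin_metric_topology:
  "openin (metric_topology S d) U \<longleftrightarrow>
     U \<subseteq> S \<and> (\<forall>x\<in>U. \<exists>r>0. \<forall>y\<in>S. d x y < r \<longrightarrow> y \<in> U)"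
proof -
  have "istopology (\<lambda>U. U \<subseteq> S \<and> (\<forall>x\<in>U. \<exists>r>0. \<forall>y\<in>S. d x y < r \<longrightarrow> y \<in> U))"
    unfolding istopology_def
  proof (intro conjI allI impI)
    fix U V
    assume U: "U \<subseteq> S \<and> (\<forall>x\<in>U. \<exists>r>0. \<forall>y\<in>S. d x y < r \<longrightarrow> y \<in> U)"
      and V: "V \<subseteq> S \<and> (\<forall>x\<in>V. \<exists>r>0. \<forall>y\<in>S. d x y < r \<longrightarrow> y \<in> V)"
    show "U \<inter> V \<subseteq> S" using U by auto
    show "\<forall>x\<in>U \<inter> V. \<exists>r>0. \<forall>y\<in>S. d x y < r \<longrightarrow> y \<in> U \<inter> V"
    proof
      fix x assume "x \<in> U \<inter> V"
      then obtain r s where "r > 0" "\<forall>y\<in>S. d x y < r \<longrightarrow> y \<in> U" "s > 0" "\<forall>y\<in>S. d x y < s \<longrightarrow> y \<in> V"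
        using U V by blast
      then show "\<exists>r>0. \<forall>y\<in>S. d x y < r \<longrightarrow> y \<in> U \<inter> V"
        by (intro exI[of _ "min r s"]) auto
    qed
  next
    fix K assume K: "\<forall>U\<in>K. U \<subseteq> S \<and> (\<forall>x\<in>U. \<exists>r>0. \<forall>y\<in>S. d x y < r \<longrightarrow> y \<in> U)"
    then show "\<Union>K \<subseteq> S" by auto
    show "\<forall>x\<in>\<Union>K. \<exists>r>0. \<forall>y\<in>S. d x y < r \<longrightarrow> y \<in> \<Union>K"
      using K by (meson UnionE UnionI)
  qed
  then show ?thesis
    by (simp add: metric_topology_def topology_inverse')
qed

lemma topspace_metric_topology [simp]: "topspace (metric_topology S d) = S"
proof
  show "topspace (metric_topology S d) \<subseteq> S"
    unfolding topspace_def by (auto simp: openin_metric_topology)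
  have "openin (metric_topology S d) S"
    unfolding openin_metric_topology by (auto intro: exI[of _ 1])
  then show "S \<subseteq> topspace (metric_topology S d)"
    by (rule openin_subset)
qed

lemma
  shows space_borel_of [simp]: "space (borel_of T) = topspace T"
    and sets_borel_of: "sets (borel_of T) = sigma_sets (topspace T) {U. openin T U}"
proof -
  have "{U. openin T U} \<subseteq> Pow (topspace T)" using openin_subset by auto
  then show "space (borel_of T) = topspace T" "sets (borel_of T) = sigma_sets (topspace T) {U. openin T U}"
    by (simp_all add: borel_of_def)
qed

lemma openin_sets_borel_of: "openin T U \<Longrightarrow> U \<in> sets (borel_of T)"
  by (auto simp: sets_borel_of)

lemma continuous_map_measurable_borel_of:
  assumes "continuous_map T T' f"
  shows "f \<in> measurable (borel_of T) (borel_of T')"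
proof (rule measurable_sigma_sets[OF sets_borel_of])
  show "{U. openin T' U} \<subseteq> Pow (topspace T')" using openin_subset by auto
  show "f \<in> space (borel_of T) \<rightarrow> topspace T'"
    using assms by (auto simp: continuous_map_def)
  fix U assume "U \<in> {U. openin T' U}"
  then have "openin T {x \<in> topspace T. f x \<in> U}"
    using assms by (auto simp: continuous_map_def)
  moreover have "f -` U \<inter> space (borel_of T) = {x \<in> topspace T. f x \<in> U}" by auto
  ultimately show "f -` U \<inter> space (borel_of T) \<in> sets (borel_of T)"
    by (simp add: openin_sets_borel_of)
qed

lemma continuous_map_metric_topologyI:
  assumes "\<And>x. x \<in> S \<Longrightarrow> f x \<in> S'"
    and "\<And>x y. x \<in> S \<Longrightarrow> y \<in> S \<Longrightarrow> d' (f x) (f y) \<le> C * d x y" and "C > 0"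
  shows "continuous_map (metric_topology S d) (metric_topology S' d') f"
  unfolding continuous_map_def
proof (intro conjI allI impI)
  show "f \<in> topspace (metric_topology S d) \<rightarrow> topspace (metric_topology S' d')"
    using assms(1) by auto
  fix U assume U: "openin (metric_topology S' d') U"
  have "\<exists>r>0. \<forall>y\<in>S. d x y < r \<longrightarrow> f y \<in> U" if "x \<in> S" "f x \<in> U" for x
  proof -
    obtain r where r: "r > 0" "\<And>z. z \<in> S' \<Longrightarrow> d' (f x) z < r \<Longrightarrow> z \<in> U"
      using U \<open>f x \<in> U\<close> unfolding openin_metric_topology by meson
    have "f y \<in> U" if y: "y \<in> S" "d x y < r / C" for y
    proof -
      have "C * d x y < r" using y \<open>C > 0\<close> by (simp add: field_simps)
      then show ?thesis
        using assms(2)[OF \<open>x \<in> S\<close> y(1)] assms(1)[OF y(1)] r(2) by (meson order_le_less_trans)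
    qed
    then show ?thesis using \<open>r > 0\<close> \<open>C > 0\<close> by (intro exI[of _ "r / C"]) auto
  qed
  then show "openin (metric_topology S d) {x \<in> topspace (metric_topology S d). f x \<in> U}"
    unfolding openin_metric_topology topspace_metric_topology by auto
qed

lemma continuous_map_metric_topology_realI:
  assumes "\<And>x y. x \<in> S \<Longrightarrow> y \<in> S \<Longrightarrow> \<bar>f x - f y\<bar> \<le> C * d x y" and "C > 0"
  shows "continuous_map (metric_topology S d) euclideanreal f"
proof -
  have "metric_topology UNIV dist = euclideanreal"
    by (simp add: topology_eq openin_metric_topology open_dist dist_commute)
  moreover have "continuous_map (metric_topology S d) (metric_topology UNIV dist) f"
    using assms by (intro continuous_map_metric_topologyI[where C = C]) (auto simp: dist_real_def)
  ultimately show ?thesis by simp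
qed

subsection \<open>The Wasserstein distance\<close>

lemma P2_sq_integrable:
  assumes "\<mu> \<in> P2"
  shows "(\<lambda>x. x) \<in> sq_integrable \<mu>"
proof -
  have [measurable_cong]: "sets \<mu> = sets borel" using assms by (auto simp: P2_def)
  have "integrable \<mu> (\<lambda>x. x\<^sup>2)"
    using assms by (intro integrableI_bounded) (auto simp: P2_def)
  moreover have "(\<lambda>x. x) \<in> borel_measurable \<mu>" by measurable
  ultimately show ?thesis by (simp add: sq_integrable_def)
qed

lemma distr_in_P2:
  assumes "prob_space M" "f \<in> sq_integrable M"
  shows "distr M borel f \<in> P2"
proof -
  interpret prob_space M by fact
  note [measurable] = sq_integrableD(1)[OF assms(2)]
  have "(\<integral>\<^sup>+ x. ennreal (x\<^sup>2) \<partial>distr M borel f) = (\<integral>\<^sup>+ q. ennreal ((f q)\<^sup>2) \<partial>M)"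
    by (rule nn_integral_distr) simp_all
  also have "\<dots> = ennreal (\<integral>q. (f q)\<^sup>2 \<partial>M)"
    using sq_integrableD(2)[OF assms(2)] by (intro nn_integral_eq_integral) auto
  also have "\<dots> < \<infinity>" by simp
  finally show ?thesis by (simp add: P2_def prob_space_distr)
qed

text \<open>The joint law of \<open>f\<close> and \<open>h\<close> is a coupling with exactly this
  cost. The bound is kept in extended reals because \<open>enn2real\<close> in \<open>W2\<close>
  would hide an infinite infimum.\<close>

lemma transport_cost_distr_le:
  assumes "f \<in> borel_measurable M" "h \<in> borel_measurable M" "(\<lambda>q. f q - h q) \<in> sq_integrable M"
  shows "(INF \<gamma>\<in>couplings (distr M borel f) (distr M borel h). \<integral>\<^sup>+ z. ennreal ((fst z - snd z)\<^sup>2) \<partial>\<gamma>)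
    \<le> ennreal (\<integral>q. (f q - h q)\<^sup>2 \<partial>M)"
proof (rule INF_lower2)
  note [measurable] = assms(1,2)
  let ?\<gamma> = "distr M borel (\<lambda>q. (f q, h q))"
  have [measurable]: "(\<lambda>q. (f q, h q)) \<in> measurable M borel"
    by (simp flip: borel_prod)
  have [measurable]: "(fst :: real \<times> real \<Rightarrow> real) \<in> measurable borel borel"
    "(snd :: real \<times> real \<Rightarrow> real) \<in> measurable borel borel"
    by (simp_all flip: borel_prod)
  show "?\<gamma> \<in> couplings (distr M borel f) (distr M borel h)"
    by (simp add: couplings_def distr_distr comp_def)
  have "(\<integral>\<^sup>+ z. ennreal ((fst z - snd z)\<^sup>2) \<partial>?\<gamma>) = (\<integral>\<^sup>+ q. ennreal ((f q - h q)\<^sup>2) \<partial>M)"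
    by (subst nn_integral_distr) simp_all
  also have "\<dots> = ennreal (\<integral>q. (f q - h q)\<^sup>2 \<partial>M)"
    using sq_integrableD(2)[OF assms(3)] by (intro nn_integral_eq_integral) auto
  finally show "(\<integral>\<^sup>+ z. ennreal ((fst z - snd z)\<^sup>2) \<partial>?\<gamma>) \<le> ennreal (\<integral>q. (f q - h q)\<^sup>2 \<partial>M)"
    by simp
qed

lemma W2_distr_le:
  assumes "f \<in> borel_measurable M" "h \<in> borel_measurable M" "(\<lambda>q. f q - h q) \<in> sq_integrable M"
  shows "W2 (distr M borel f) (distr M borel h) \<le> L2norm M (\<lambda>q. f q - h q)"
proof -
  have "enn2real (INF \<gamma>\<in>couplings (distr M borel f) (distr M borel h). \<integral>\<^sup>+ z. ennreal ((fst z - snd z)\<^sup>2) \<partial>\<gamma>)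
    \<le> (\<integral>q. (f q - h q)\<^sup>2 \<partial>M)"
    using transport_cost_distr_le[OF assms] by (intro enn2real_leI) simp_all
  then show ?thesis unfolding W2_def L2norm_def by (rule real_sqrt_le_mono)
qed

text \<open>A strict bound on the infimum selects a near-optimal coupling. On it
  \<open>\<mu>\<close> and \<open>\<nu>\<close> become the laws of \<open>fst\<close> and
  \<open>snd\<close>, so estimates for laws of functions on a common space apply to them.\<close>

lemma W2_lessE:
  assumes "\<mu> \<in> P2" "\<nu> \<in> P2" "W2 \<mu> \<nu> < r"
  obtains \<gamma> where "prob_space \<gamma>" "sets \<gamma> = sets borel"
    "distr \<gamma> borel fst = \<mu>" "distr \<gamma> borel snd = \<nu>"
    "(\<lambda>z. fst z - snd z) \<in> sq_integrable \<gamma>" "L2norm \<gamma> (\<lambda>z. fst z - snd z) < r"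
proof -
  let ?c = "\<lambda>\<gamma>. \<integral>\<^sup>+ z. ennreal ((fst z - snd z)\<^sup>2) \<partial>(\<gamma> :: (real \<times> real) measure)"
  have [measurable]: "(fst :: real \<times> real \<Rightarrow> real) \<in> measurable borel borel"
    "(snd :: real \<times> real \<Rightarrow> real) \<in> measurable borel borel"
    by (simp_all flip: borel_prod)
  have sm [measurable_cong]: "sets \<mu> = sets borel" "sets \<nu> = sets borel"
    and pm: "prob_space \<mu>" "prob_space \<nu>"
    using assms by (auto simp: P2_def)
  interpret \<mu>: prob_space \<mu> by fact
  interpret \<nu>: prob_space \<nu> by fact
  interpret P: pair_prob_space \<mu> \<nu> ..
  have d1: "distr (\<mu> \<Otimes>\<^sub>M \<nu>) borel fst = \<mu>"
    using \<nu>.distr_pair_fst[of \<mu>] sm(1) by (simp cong: distr_cong)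
  have d2: "distr (\<mu> \<Otimes>\<^sub>M \<nu>) borel snd = \<nu>"
  proof (rule measure_eqI)
    fix A assume "A \<in> sets (distr (\<mu> \<Otimes>\<^sub>M \<nu>) borel snd)"
    then have A: "A \<in> sets \<nu>" by (simp add: sm)
    then have "snd -` A \<inter> space (\<mu> \<Otimes>\<^sub>M \<nu>) = space \<mu> \<times> A"
      using sets.sets_into_space[OF A] by (auto simp: space_pair_measure)
    then show "emeasure (distr (\<mu> \<Otimes>\<^sub>M \<nu>) borel snd) A = emeasure \<nu> A"
      using A sets.top[of \<mu>]
      by (simp add: emeasure_distr \<nu>.emeasure_pair_measure_Times \<mu>.emeasure_space_1 sm(2))
  qed (simp add: sm)
  \<comment> \<open>Since \<open>enn2real\<close> sends infinity to \<open>0\<close>, a small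
    \<open>W2\<close> says nothing until the infimum is known to be finite. The product coupling
    shows this, both second moments being finite.\<close>
  have "fst \<in> sq_integrable (\<mu> \<Otimes>\<^sub>M \<nu>)"
    using sq_integrableD(2)[OF P2_sq_integrable[OF assms(1)]]
    by (subst (asm) d1[symmetric]) (simp add: integrable_distr_eq sq_integrable_def)
  moreover have "snd \<in> sq_integrable (\<mu> \<Otimes>\<^sub>M \<nu>)"
    using sq_integrableD(2)[OF P2_sq_integrable[OF assms(2)]]
    by (subst (asm) d2[symmetric]) (simp add: integrable_distr_eq sq_integrable_def)
  ultimately have "(INF \<gamma>\<in>couplings \<mu> \<nu>. ?c \<gamma>) \<le> ennreal (\<integral>z. (fst z - snd z)\<^sup>2 \<partial>(\<mu> \<Otimes>\<^sub>M \<nu>))"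
    using transport_cost_distr_le[of fst "\<mu> \<Otimes>\<^sub>M \<nu>" snd] sq_integrable_diff[of fst "\<mu> \<Otimes>\<^sub>M \<nu>" snd]
    by (simp add: d1 d2)
  then have fin: "(INF \<gamma>\<in>couplings \<mu> \<nu>. ?c \<gamma>) < top"
    by (rule order_le_less_trans) simp
  have r: "r > 0" using assms(3) by (rule order_le_less_trans[rotated]) (simp add: W2_def)
  have "sqrt (enn2real (INF \<gamma>\<in>couplings \<mu> \<nu>. ?c \<gamma>)) < sqrt (r\<^sup>2)"
    using assms(3) r unfolding W2_def by simp
  then have "enn2real (INF \<gamma>\<in>couplings \<mu> \<nu>. ?c \<gamma>) < r\<^sup>2"
    by (simp only: real_sqrt_less_iff)
  then have "(INF \<gamma>\<in>couplings \<mu> \<nu>. ?c \<gamma>) < ennreal (r\<^sup>2)"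
    using fin by (subst ennreal_enn2real[symmetric]) (auto intro!: ennreal_lessI simp: r)
  then obtain \<gamma> where \<gamma>: "\<gamma> \<in> couplings \<mu> \<nu>" "?c \<gamma> < ennreal (r\<^sup>2)"
    unfolding INF_less_iff by blast
  have sg [measurable_cong]: "sets \<gamma> = sets borel" and dg: "distr \<gamma> borel fst = \<mu>" "distr \<gamma> borel snd = \<nu>"
    using \<gamma>(1) by (auto simp: couplings_def)
  have m [measurable]: "(\<lambda>z. fst z - snd z) \<in> borel_measurable \<gamma>" by measurable
  have int: "integrable \<gamma> (\<lambda>z. (fst z - snd z)\<^sup>2)"
    using \<gamma>(2) by (intro integrableI_bounded) (auto intro: order_less_trans)
  have "ennreal (\<integral>z. (fst z - snd z)\<^sup>2 \<partial>\<gamma>) < ennreal (r\<^sup>2)"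
    using \<gamma>(2) nn_integral_eq_integral[OF int] by simp
  then have "(\<integral>z. (fst z - snd z)\<^sup>2 \<partial>\<gamma>) < r\<^sup>2"
    by (simp add: ennreal_less_iff)
  then have "L2norm \<gamma> (\<lambda>z. fst z - snd z) < r"
    using r by (intro power2_less_imp_less[of _ r]) (auto simp: L2norm_squared)
  moreover have "prob_space \<gamma>"
    using pm(1) by (intro prob_space_distrD[of fst \<gamma> borel]) (simp_all add: dg)
  ultimately show ?thesis
    using that sg dg m int by (auto simp: sq_integrable_def)
qed

text \<open>The Lipschitz estimate for laws, applied to the coordinates of a near-optimal coupling,
  makes \<open>concentration n\<close> Lipschitz for \<open>W2\<close>.\<close>

lemma openin_concentration_less:
  "openin (metric_topology P2 W2) {\<mu> \<in> P2. concentration n \<mu> < c}"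
  unfolding openin_metric_topology
proof (intro conjI ballI)
  fix \<mu> assume "\<mu> \<in> {\<mu> \<in> P2. concentration n \<mu> < c}"
  then have \<mu>: "\<mu> \<in> P2" "concentration n \<mu> < c" by auto
  \<comment> \<open>The added \<open>1\<close> keeps the denominator positive at
    \<open>n = 0\<close> and makes the final inequality strict.\<close>
  define r where "r = (c - concentration n \<mu>) / (2 * real n + 1)"
  have r: "r > 0" using \<mu> by (simp add: r_def)
  have "concentration n \<nu> < c" if \<nu>: "\<nu> \<in> P2" "W2 \<mu> \<nu> < r" for \<nu>
  proof -
    obtain \<gamma> where g: "prob_space \<gamma>" "sets \<gamma> = sets borel"
      "distr \<gamma> borel fst = \<mu>" "distr \<gamma> borel snd = \<nu>"
      "(\<lambda>z. fst z - snd z) \<in> sq_integrable \<gamma>" "L2norm \<gamma> (\<lambda>z. fst z - snd z) < r"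
      by (rule W2_lessE[OF \<mu>(1) \<nu>])
    note [measurable_cong] = g(2)
    have [measurable]: "(fst :: real \<times> real \<Rightarrow> real) \<in> measurable borel borel"
      "(snd :: real \<times> real \<Rightarrow> real) \<in> measurable borel borel"
      by (simp_all flip: borel_prod)
    have "fst \<in> borel_measurable \<gamma>" "snd \<in> borel_measurable \<gamma>"
      by measurable
    then have "\<bar>concentration n \<mu> - concentration n \<nu>\<bar> \<le> 2 * real n * L2norm \<gamma> (\<lambda>z. fst z - snd z)"
      using concentration_distr_Lipschitz[OF g(1) _ _ g(5), of n] unfolding g(3,4) by blast
    also have "\<dots> \<le> 2 * real n * r"
      using g(6) by (intro mult_left_mono) auto
    also have "\<dots> < (2 * real n + 1) * r" using r by (simp add: algebra_simps)
    also have "\<dots> = c - concentration n \<mu>" by (simp add: r_def)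
    finally show ?thesis by linarith
  qed
  then show "\<exists>r>0. \<forall>\<nu>\<in>P2. W2 \<mu> \<nu> < r \<longrightarrow> \<nu> \<in> {\<mu> \<in> P2. concentration n \<mu> < c}"
    using r by auto
qed auto

text \<open>An atom is a set here, not a point. Cut into countably many slices of width
  \<open>1/(2 n)\<close>, it has a slice of positive mass, which by minimality carries all of its
  mass; on that slice \<open>tent n (x - y)\<close> is at least \<open>1/2\<close>. For
  \<open>n = 0\<close> the slice \<open>I 0\<close> is the whole atom.\<close>

lemma concentration_ge_atom:
  assumes "prob_space \<mu>" and sets [measurable_cong]: "sets \<mu> = sets borel" and A: "is_atom \<mu> A"
  shows "(measure \<mu> A)\<^sup>2 / 2 \<le> concentration n \<mu>"
proof -
  interpret prob_space \<mu> by fact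
  have A_sets [measurable]: "A \<in> sets \<mu>" and A_pos: "0 < emeasure \<mu> A"
    and A_min: "\<And>B. B \<in> sets \<mu> \<Longrightarrow> B \<subseteq> A \<Longrightarrow> emeasure \<mu> B = 0 \<or> emeasure \<mu> B = emeasure \<mu> A"
    using A by (auto simp: is_atom_def)
  define I where "I i = {x \<in> A. \<lfloor>2 * real n * x\<rfloor> = i}" for i :: int
  have I_sets [measurable]: "I i \<in> sets \<mu>" for i
  proof -
    have "{x \<in> space \<mu>. x \<in> A \<and> \<lfloor>2 * real n * x\<rfloor> = i} \<in> sets \<mu>" by measurable
    moreover have "{x \<in> space \<mu>. x \<in> A \<and> \<lfloor>2 * real n * x\<rfloor> = i} = I i"
      using sets.sets_into_space[OF A_sets] by (auto simp: I_def)
    ultimately show ?thesis by simp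
  qed
  have "\<exists>i. emeasure \<mu> (I i) \<noteq> 0"
  proof (rule ccontr)
    assume "\<not> ?thesis"
    then have "(\<Union>i. I i) \<in> null_sets \<mu>"
      by (intro null_sets_UN) (auto intro!: null_setsI)
    moreover have "(\<Union>i. I i) = A" by (auto simp: I_def)
    ultimately show False using A_pos by auto
  qed
  then obtain i where "emeasure \<mu> (I i) = emeasure \<mu> A"
    using A_min[OF I_sets] by (auto simp: I_def)
  then have meas: "measure \<mu> (I i) = measure \<mu> A" by (simp add: measure_def)
  have tent_ge: "indicator (I i) x * (indicator (I i) y / 2) \<le> tent n (x - y)" for x y
  proof (cases "x \<in> I i \<and> y \<in> I i")
    case True
    then have "\<bar>2 * real n * x - 2 * real n * y\<bar> < 1"
      unfolding I_def by (auto simp: floor_eq_iff abs_less_iff)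
    also have "2 * real n * x - 2 * real n * y = 2 * real n * (x - y)" by (simp add: algebra_simps)
    finally have "real n * \<bar>x - y\<bar> < 1 / 2" by (simp add: abs_mult)
    then show ?thesis using True by (simp add: tent_def)
  qed (auto simp: tent_bounds indicator_def)
  have bdd: "integrable \<mu> (\<lambda>y. tent n (x - y))" for x
    by (rule integrable_const_bound[where B = 1]) (auto simp: tent_bounds)
  have bdd2: "integrable \<mu> (\<lambda>x. \<integral>y. tent n (x - y) \<partial>\<mu>)"
  proof (rule integrable_const_bound[where B = 1])
    show "AE x in \<mu>. norm (\<integral>y. tent n (x - y) \<partial>\<mu>) \<le> 1"
      using bdd prob_space
      by (intro AE_I2) (auto simp: tent_bounds integral_nonneg intro!: integral_le_const)
  qed measurable
  have ind: "integrable \<mu> (indicator (I i) :: real \<Rightarrow> real)"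
    by (rule integrable_const_bound[where B = 1]) (auto simp: indicator_def)
  have ind_int: "(\<integral>x. indicator (I i) x \<partial>\<mu>) = measure \<mu> (I i)"
    using sets.sets_into_space[OF I_sets] by (simp add: Int_absorb2)
  have "(measure \<mu> A)\<^sup>2 / 2 = (\<integral>x. indicator (I i) x * (measure \<mu> (I i) / 2) \<partial>\<mu>)"
    using ind ind_int by (simp add: meas power2_eq_square)
  also have "\<dots> \<le> concentration n \<mu>"
    unfolding concentration_def
  proof (rule integral_mono[OF _ bdd2])
    show "integrable \<mu> (\<lambda>x. indicator (I i) x * (measure \<mu> (I i) / 2))" using ind by simp
    fix x
    have "indicator (I i) x * (measure \<mu> (I i) / 2) = (\<integral>y. indicator (I i) x * (indicator (I i) y / 2) \<partial>\<mu>)"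
      using ind ind_int by simp
    also have "\<dots> \<le> (\<integral>y. tent n (x - y) \<partial>\<mu>)"
      by (rule integral_mono[OF _ bdd tent_ge]) (use ind in simp)
    finally show "indicator (I i) x * (measure \<mu> (I i) / 2) \<le> (\<integral>y. tent n (x - y) \<partial>\<mu>)" .
  qed
  finally show ?thesis .
qed

text \<open>The lower bound produced by an atom does not depend on \<open>n\<close>, so arbitrarily
  small concentrations exclude atoms. The countable quantifiers keep the criterion measurable in
  \<open>\<mu>\<close>.\<close>

lemma P2_regularI:
  assumes "\<mu> \<in> P2" and "\<And>j. \<exists>n. concentration n \<mu> < 1 / real (Suc j)"
  shows "\<mu> \<in> P2_regular"
proof -
  have \<mu>: "prob_space \<mu>" "sets \<mu> = sets borel" using assms(1) by (auto simp: P2_def)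
  interpret prob_space \<mu> by fact
  have "\<not> is_atom \<mu> A" for A
  proof
    assume A: "is_atom \<mu> A"
    then have "0 < measure \<mu> A"
      by (auto simp: is_atom_def emeasure_eq_measure)
    then obtain j where "1 / real (Suc j) < (measure \<mu> A)\<^sup>2 / 2"
      using nat_approx_posE[of "(measure \<mu> A)\<^sup>2 / 2"] by auto
    with assms(2)[of j] concentration_ge_atom[OF \<mu> A] show False
      by (meson less_trans not_le)
  qed
  then show ?thesis using assms(1) by (auto simp: P2_regular_def atomless_def)
qed

subsection \<open>The law map\<close>

lemma rep_in_L2_class: "f \<in> sq_integrable M \<Longrightarrow> rep (L2_class M f) \<in> L2_class M f"
  unfolding rep_def by (rule someI[of _ f]) (auto simp: L2_class_def)

lemma rep_sq_integrable: "u \<in> L2 M \<Longrightarrow> rep u \<in> sq_integrable M"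
  using rep_in_L2_class by (fastforce simp: L2_def L2_class_def)

lemma AE_rep_L2_class: "f \<in> sq_integrable M \<Longrightarrow> AE q in M. rep (L2_class M f) q = f q"
  using rep_in_L2_class[of f M] by (simp add: L2_class_def)

lemma L2_class_in_L2: "f \<in> sq_integrable M \<Longrightarrow> L2_class M f \<in> L2 M"
  by (simp add: L2_def)

lemma L2_dist_eq: "L2_dist M u v = L2norm M (\<lambda>q. rep u q - rep v q)"
  by (simp add: L2_dist_def L2norm_def)

lemma space_borel_L2 [simp]: "space (borel_L2 M) = L2 M"
  by (simp add: borel_L2_def L2_topology_def)

lemma space_borel_P2 [simp]: "space borel_P2 = P2"
  by (simp add: borel_P2_def)

lemma iota_in_P2: "prob_space M \<Longrightarrow> u \<in> L2 M \<Longrightarrow> iota M u \<in> P2"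
  unfolding iota_def by (intro distr_in_P2 rep_sq_integrable)

lemma iota_measurable:
  assumes "prob_space M"
  shows "iota M \<in> measurable (borel_L2 M) borel_P2"
  unfolding borel_L2_def borel_P2_def L2_topology_def
proof (intro continuous_map_measurable_borel_of continuous_map_metric_topologyI[where C = 1])
  fix u v assume "u \<in> L2 M" "v \<in> L2 M"
  then have "rep u \<in> sq_integrable M" "rep v \<in> sq_integrable M" by (auto intro: rep_sq_integrable)
  then show "W2 (iota M u) (iota M v) \<le> 1 * L2_dist M u v"
    unfolding iota_def L2_dist_eq
    using W2_distr_le[of "rep u" M "rep v"] sq_integrable_diff[of "rep u" M "rep v"] sq_integrableD(1)
    by auto
qed (auto intro: iota_in_P2[OF assms])

subsection \<open>Averages over the cells of a countable generator\<close>

text \<open>Every open set is a countable union of members of a countable base, so the base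
  generates the Borel sets.\<close>

lemma standard_borel_countably_generated:
  assumes "standard_borel M"
  obtains B :: "nat \<Rightarrow> 'q set" where "sets (M :: 'q measure) = sigma_sets (space M) (range B)"
proof -
  obtain T where T: "second_countable T" "topspace T = space M" "sets M = sets (borel_of T)"
    using assms unfolding standard_borel_def by blast
  obtain \<B> where \<B>': "countable \<B> \<and> (\<forall>V\<in>\<B>. openin T V) \<and>
      (\<forall>U x. openin T U \<and> x \<in> U \<longrightarrow> (\<exists>V\<in>\<B>. x \<in> V \<and> V \<subseteq> U))"
    using T(1) unfolding second_countable_def ..
  have \<B>: "countable \<B>" "\<And>V. V \<in> \<B> \<Longrightarrow> openin T V"
      "\<And>U x. openin T U \<Longrightarrow> x \<in> U \<Longrightarrow> \<exists>V\<in>\<B>. x \<in> V \<and> V \<subseteq> U"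
    using \<B>' by simp_all
  \<comment> \<open>The inserted empty set guarantees a nonempty family, which
    \<open>from_nat_into\<close> then enumerates exactly.\<close>
  define B where "B = from_nat_into (insert {} \<B>)"
  have B: "range B = insert {} \<B>"
    unfolding B_def using \<B>(1) by (intro range_from_nat_into) auto
  have "sigma_sets (space M) {U. openin T U} = sigma_sets (space M) (range B)"
  proof (rule sigma_sets_eqI)
    fix U assume "U \<in> {U. openin T U}"
    then have "U = \<Union>{V \<in> \<B>. V \<subseteq> U}" using \<B>(3) by blast
    moreover have "\<Union>{V \<in> \<B>. V \<subseteq> U} \<in> sigma_sets (space M) (range B)"
    proof (rule sigma_sets_UNION)
      show "countable {V \<in> \<B>. V \<subseteq> U}" using \<B>(1) by (rule countable_subset[rotated]) auto
    qed (auto simp: B)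
    ultimately show "U \<in> sigma_sets (space M) (range B)" by simp
  next
    fix V assume "V \<in> range B"
    then have "openin T V" using \<B>(2) B by auto
    then show "V \<in> sigma_sets (space M) {U. openin T U}" by auto
  qed
  then show ?thesis using that T by (simp add: sets_borel_of)
qed

locale countably_generated_prob_space = prob_space M for M :: "'q measure" +
  fixes B :: "nat \<Rightarrow> 'q set"
  assumes sets_generated: "sets M = sigma_sets (space M) (range B)"
begin

text \<open>Points with the same code form an atom of the finite algebra generated by the first
  \<open>N\<close> sets. Encoding the pattern as a subset of \<open>{..<N}\<close> turns passing to
  a coarser partition into an intersection.\<close>

definition code :: "nat \<Rightarrow> 'q \<Rightarrow> nat set" where
  "code N q = {i. i < N \<and> q \<in> B i}"

definition cell :: "nat \<Rightarrow> nat set \<Rightarrow> 'q set" where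
  "cell N c = {q \<in> space M. code N q = c}"

text \<open>On a null cell the division by zero gives the zero weight, so the average over such a
  cell is \<open>0\<close>.\<close>

definition avg_weight :: "nat \<Rightarrow> nat set \<Rightarrow> 'q \<Rightarrow> real" where
  "avg_weight N c q = indicator (cell N c) q / prob (cell N c)"

text \<open>The conditional expectation given the code, written out as an integral against a weight.
  Thus for fixed \<open>q\<close> it is a continuous linear functional of the class of
  \<open>f\<close>, and its law under \<open>g\<close> is accessible.\<close>

definition cond_avg :: "nat \<Rightarrow> ('q \<Rightarrow> real) \<Rightarrow> 'q \<Rightarrow> real" where
  "cond_avg N f q = (\<integral>x. f x * avg_weight N (code N q) x \<partial>M)"

lemma code_in_Pow: "code N q \<in> Pow {..<N}"
  by (auto simp: code_def)

lemma code_mono: "N \<le> N' \<Longrightarrow> code N q = code N' q \<inter> {..<N}"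
  by (auto simp: code_def)

lemma B_sets [measurable]: "B i \<in> sets M"
  by (auto simp: sets_generated)

lemma code_measurable [measurable]: "code N \<in> measurable M (count_space (Pow {..<N}))"
proof -
  have "code N -` {c} \<inter> space M \<in> sets M" if c: "c \<subseteq> {..<N}" for c
  proof -
    have "{q \<in> space M. \<forall>i<N. q \<in> B i \<longleftrightarrow> i \<in> c} \<in> sets M" by measurable
    moreover have "code N q = c \<longleftrightarrow> (\<forall>i<N. q \<in> B i \<longleftrightarrow> i \<in> c)" for q
      unfolding code_def set_eq_iff mem_Collect_eq using c by blast
    then have "code N -` {c} \<inter> space M = {q \<in> space M. \<forall>i<N. q \<in> B i \<longleftrightarrow> i \<in> c}"
      by auto
    ultimately show ?thesis by simp
  qed
  moreover have "code N \<in> space M \<rightarrow> Pow {..<N}" using code_in_Pow by blast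
  ultimately show ?thesis
    by (subst measurable_count_space_eq2) (simp_all add: Pow_iff)
qed

lemma cell_sets [measurable]: "cell N c \<in> sets M"
proof (cases "c \<in> Pow {..<N}")
  case True
  then have "code N -` {c} \<inter> space M \<in> sets M"
    using measurable_sets[OF code_measurable] by auto
  moreover have "code N -` {c} \<inter> space M = cell N c" by (auto simp: cell_def)
  ultimately show ?thesis by simp
next
  case False
  then have "cell N c = {}" using code_in_Pow by (auto simp: cell_def)
  then show ?thesis by simp
qed

lemma step_measurable [measurable]:
  fixes \<phi> :: "nat set \<Rightarrow> real"
  shows "(\<lambda>q. \<phi> (code N q)) \<in> borel_measurable M"
  by (rule measurable_compose[OF code_measurable]) simp

lemma step_sum: "q \<in> space M \<Longrightarrow> \<phi> (code N q) = (\<Sum>c\<in>Pow {..<N}. \<phi> c * indicator (cell N c) q)"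
  for \<phi> :: "nat set \<Rightarrow> real"
proof -
  assume q: "q \<in> space M"
  have "(\<Sum>c\<in>Pow {..<N}. \<phi> c * indicator (cell N c) q) = (\<Sum>c\<in>Pow {..<N}. if c = code N q then \<phi> c else 0)"
    using q by (intro sum.cong) (auto simp: cell_def indicator_def)
  also have "\<dots> = \<phi> (code N q)" using code_in_Pow[of N q] by simp
  finally show ?thesis by simp
qed

lemma step_sq_integrable: "(\<lambda>q. \<phi> (code N q)) \<in> sq_integrable M"
  by (rule sq_integrable_bounded[where B = "\<Sum>c\<in>Pow {..<N}. \<bar>\<phi> c\<bar>"])
    (auto intro!: member_le_sum[where f = "\<lambda>c. \<bar>\<phi> c\<bar>"] code_in_Pow)

lemma avg_weight_sq_integrable: "avg_weight N c \<in> sq_integrable M"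
  by (rule sq_integrable_bounded[where B = "1 / prob (cell N c)"])
    (auto simp: avg_weight_def[abs_def] indicator_def)

lemma indicator_sq_integrable: "A \<in> sets M \<Longrightarrow> (indicator A :: 'q \<Rightarrow> real) \<in> sq_integrable M"
  by (rule sq_integrable_bounded[where B = 1]) (auto simp: indicator_def)

lemma integral_indicator_cell:
  assumes "f \<in> sq_integrable M"
  shows "(\<integral>x. f x * indicator (cell N c) x \<partial>M) = prob (cell N c) * (\<integral>x. f x * avg_weight N c x \<partial>M)"
proof (cases "prob (cell N c) = 0")
  case True
  then have "AE x in M. x \<notin> cell N c"
    by (intro AE_not_in) (simp add: null_sets_def emeasure_eq_measure)
  then have "AE x in M. f x * indicator (cell N c) x = 0"
    by eventually_elim simp
  then show ?thesis using True by (simp add: integral_eq_zero_AE)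
next
  case False
  have "(\<integral>x. f x * avg_weight N c x \<partial>M) = (\<integral>x. f x * indicator (cell N c) x / prob (cell N c) \<partial>M)"
    by (simp add: avg_weight_def)
  then show ?thesis using False by simp
qed

lemma integral_mult_step:
  assumes "f \<in> sq_integrable M"
  shows "(\<integral>q. f q * \<psi> (code N q) \<partial>M)
    = (\<Sum>c\<in>Pow {..<N}. \<psi> c * (prob (cell N c) * (\<integral>x. f x * avg_weight N c x \<partial>M)))"
proof -
  have "(\<integral>q. f q * \<psi> (code N q) \<partial>M) = (\<integral>q. (\<Sum>c\<in>Pow {..<N}. \<psi> c * (f q * indicator (cell N c) q)) \<partial>M)"
    by (intro Bochner_Integration.integral_cong refl)
      (simp only: step_sum[of _ \<psi>] sum_distrib_left mult.left_commute)
  also have "\<dots> = (\<Sum>c\<in>Pow {..<N}. (\<integral>q. \<psi> c * (f q * indicator (cell N c) q) \<partial>M))"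
    by (rule Bochner_Integration.integral_sum)
      (intro integrable_mult_right integrable_mult_sq assms indicator_sq_integrable cell_sets)
  also have "\<dots> = (\<Sum>c\<in>Pow {..<N}. \<psi> c * (prob (cell N c) * (\<integral>x. f x * avg_weight N c x \<partial>M)))"
    by (simp add: integral_indicator_cell[OF assms])
  finally show ?thesis .
qed

lemma cond_avg_sq_integrable: "cond_avg N f \<in> sq_integrable M"
  unfolding cond_avg_def[abs_def]
  by (rule step_sq_integrable[of "\<lambda>c. \<integral>x. f x * avg_weight N c x \<partial>M"])

lemma integral_step:
  "(\<integral>q. \<psi> (code N q) \<partial>M) = (\<Sum>c\<in>Pow {..<N}. \<psi> c * prob (cell N c))" for \<psi> :: "nat set \<Rightarrow> real"
proof -
  have "(\<integral>q. \<psi> (code N q) \<partial>M) = (\<integral>q. (\<Sum>c\<in>Pow {..<N}. \<psi> c * indicator (cell N c) q) \<partial>M)"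
    by (intro Bochner_Integration.integral_cong) (simp_all add: step_sum)
  also have "\<dots> = (\<Sum>c\<in>Pow {..<N}. (\<integral>q. \<psi> c * indicator (cell N c) q \<partial>M))"
    by (rule Bochner_Integration.integral_sum)
      (intro integrable_mult_right sq_integrable_integrable indicator_sq_integrable cell_sets)
  also have "\<dots> = (\<Sum>c\<in>Pow {..<N}. \<psi> c * prob (cell N c))"
    using sets.sets_into_space[OF cell_sets] by (simp add: Int_absorb2)
  finally show ?thesis .
qed

text \<open>The characteristic property of a conditional expectation, obtained because both
  integrals expand to the same sum over cells.\<close>

lemma integral_cond_avg_mult_step:
  assumes "f \<in> sq_integrable M"
  shows "(\<integral>q. cond_avg N f q * \<psi> (code N q) \<partial>M) = (\<integral>q. f q * \<psi> (code N q) \<partial>M)"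
  unfolding integral_mult_step[OF assms] cond_avg_def
  by (subst integral_step[of "\<lambda>c. (\<integral>x. f x * avg_weight N c x \<partial>M) * \<psi> c"]) (simp add: ac_simps)

lemma integral_cond_avg_squared:
  "(\<integral>q. (cond_avg N f q)\<^sup>2 \<partial>M) = (\<Sum>c\<in>Pow {..<N}. prob (cell N c) * (\<integral>x. f x * avg_weight N c x \<partial>M)\<^sup>2)"
  unfolding cond_avg_def
  by (subst integral_step[of "\<lambda>c. (\<integral>x. f x * avg_weight N c x \<partial>M)\<^sup>2"]) (simp add: ac_simps)

text \<open>The error of the average is orthogonal to every function of the code, in particular to
  \<open>D\<close>, so the cross term vanishes. Taking \<open>\<phi> = 0\<close> gives the residual
  identity, and dropping a square gives best approximation.\<close>

lemma cond_avg_pythagoras: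
  assumes f: "f \<in> sq_integrable M"
  shows "(\<integral>q. (f q - \<phi> (code N q))\<^sup>2 \<partial>M)
    = (\<integral>q. (f q - cond_avg N f q)\<^sup>2 \<partial>M) + (\<integral>q. (cond_avg N f q - \<phi> (code N q))\<^sup>2 \<partial>M)"
proof -
  define P where "P = cond_avg N f"
  define D where "D q = P q - \<phi> (code N q)" for q
  have P: "P \<in> sq_integrable M" unfolding P_def by (rule cond_avg_sq_integrable)
  have D: "D \<in> sq_integrable M" unfolding D_def
    by (intro sq_integrable_diff P step_sq_integrable)
  have fP: "(\<lambda>q. f q - P q) \<in> sq_integrable M" by (rule sq_integrable_diff[OF f P])
  have eq: "(\<integral>q. P q * D q \<partial>M) = (\<integral>q. f q * D q \<partial>M)"
    unfolding D_def P_def cond_avg_def[of N f]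
    using integral_cond_avg_mult_step[OF f, of N "\<lambda>c. (\<integral>x. f x * avg_weight N c x \<partial>M) - \<phi> c"]
    by (simp add: cond_avg_def)
  have "(\<lambda>q. (f q - \<phi> (code N q))\<^sup>2) = (\<lambda>q. (f q - P q)\<^sup>2 + (D q)\<^sup>2 + 2 * (f q * D q - P q * D q))"
    by (auto simp: D_def power2_eq_square algebra_simps)
  then have "(\<integral>q. (f q - \<phi> (code N q))\<^sup>2 \<partial>M)
      = (\<integral>q. (f q - P q)\<^sup>2 \<partial>M) + (\<integral>q. (D q)\<^sup>2 \<partial>M)
        + 2 * ((\<integral>q. f q * D q \<partial>M) - (\<integral>q. P q * D q \<partial>M))"
    using sq_integrableD(2)[OF fP] sq_integrableD(2)[OF D] integrable_mult_sq[OF f D]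
      integrable_mult_sq[OF P D] by simp
  then show ?thesis using eq by (simp add: D_def P_def)
qed

lemma cond_avg_residual:
  assumes "f \<in> sq_integrable M"
  shows "(\<integral>q. (f q - cond_avg N f q)\<^sup>2 \<partial>M) = (\<integral>q. (f q)\<^sup>2 \<partial>M) - (\<integral>q. (cond_avg N f q)\<^sup>2 \<partial>M)"
  using cond_avg_pythagoras[OF assms, where \<phi> = "\<lambda>_. 0" and N = N] by simp

lemma cond_avg_best:
  assumes "f \<in> sq_integrable M"
  shows "(\<integral>q. (f q - cond_avg N f q)\<^sup>2 \<partial>M) \<le> (\<integral>q. (f q - \<phi> (code N q))\<^sup>2 \<partial>M)"
  using cond_avg_pythagoras[OF assms] by simp

section \<open>Density of step functions among square-integrable functions\<close>

definition step_approximable :: "('q \<Rightarrow> real) \<Rightarrow> bool" where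
  "step_approximable f \<longleftrightarrow> f \<in> sq_integrable M \<and>
     (\<forall>e>0. \<exists>N \<phi>. L2norm M (\<lambda>q. f q - \<phi> (code N q)) < e)"

lemma step_approximable_add:
  assumes "step_approximable f" "step_approximable h"
  shows "step_approximable (\<lambda>q. f q + h q)"
  unfolding step_approximable_def
proof (intro conjI allI impI)
  have fh: "f \<in> sq_integrable M" "h \<in> sq_integrable M"
    using assms by (auto simp: step_approximable_def)
  then show "(\<lambda>q. f q + h q) \<in> sq_integrable M" by (rule sq_integrable_add)
  fix e :: real assume "e > 0"
  then obtain N \<phi> N' \<psi> where
    1: "L2norm M (\<lambda>q. f q - \<phi> (code N q)) < e / 2" and 2: "L2norm M (\<lambda>q. h q - \<psi> (code N' q)) < e / 2"
    using assms unfolding step_approximable_def by (meson half_gt_zero)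
  \<comment> \<open>Both step functions live on the finer of the two partitions; intersecting its
    code with \<open>{..<N}\<close> recovers the coarser code.\<close>
  define K where "K = max N N'"
  define \<theta> where "\<theta> c = \<phi> (c \<inter> {..<N}) + \<psi> (c \<inter> {..<N'})" for c
  have "(\<lambda>q. f q + h q - \<theta> (code K q)) = (\<lambda>q. (f q - \<phi> (code N q)) + (h q - \<psi> (code N' q)))"
    using code_mono[of N K] code_mono[of N' K] by (auto simp: \<theta>_def K_def)
  then have "L2norm M (\<lambda>q. f q + h q - \<theta> (code K q))
      \<le> L2norm M (\<lambda>q. f q - \<phi> (code N q)) + L2norm M (\<lambda>q. h q - \<psi> (code N' q))"
    by (simp only:) (intro L2norm_triangle sq_integrable_diff fh step_sq_integrable)
  then show "\<exists>N \<phi>. L2norm M (\<lambda>q. f q + h q - \<phi> (code N q)) < e"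
    using 1 2 by (intro exI[of _ K] exI[of _ \<theta>]) linarith
qed

lemma step_approximable_step: "step_approximable (\<lambda>q. \<phi> (code N q))"
  unfolding step_approximable_def
proof (intro conjI allI impI step_sq_integrable)
  fix e :: real assume "e > 0"
  then show "\<exists>N' \<psi>. L2norm M (\<lambda>q. \<phi> (code N q) - \<psi> (code N' q)) < e"
    by (intro exI[of _ N] exI[of _ \<phi>]) (simp add: L2norm_def)
qed

lemma step_approximable_scale:
  assumes "step_approximable f"
  shows "step_approximable (\<lambda>q. a * f q)"
proof (cases "a = 0")
  case True
  then show ?thesis using step_approximable_step[of "\<lambda>_. 0"] by simp
next
  case a: False
  show ?thesis
    unfolding step_approximable_def
  proof (intro conjI allI impI)
    show "(\<lambda>q. a * f q) \<in> sq_integrable M"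
      using assms by (auto simp: step_approximable_def intro: sq_integrable_scale)
    fix e :: real assume "e > 0"
    then have "e / \<bar>a\<bar> > 0" using a by simp
    then obtain N \<phi> where N: "L2norm M (\<lambda>q. f q - \<phi> (code N q)) < e / \<bar>a\<bar>"
      using assms unfolding step_approximable_def by blast
    have "L2norm M (\<lambda>q. a * f q - a * \<phi> (code N q)) = \<bar>a\<bar> * L2norm M (\<lambda>q. f q - \<phi> (code N q))"
      by (simp add: L2norm_def right_diff_distrib[symmetric] power_mult_distrib real_sqrt_mult)
    then show "\<exists>N \<phi>. L2norm M (\<lambda>q. a * f q - \<phi> (code N q)) < e"
      using N a by (intro exI[of _ N] exI[of _ "\<lambda>c. a * \<phi> c"]) (simp add: field_simps)
  qed
qed

lemma step_approximable_sum:
  assumes "\<And>i. i \<in> I \<Longrightarrow> step_approximable (f i)"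
  shows "step_approximable (\<lambda>q. \<Sum>i\<in>I. f i q)"
  using assms
proof (induction I rule: infinite_finite_induct)
  case (insert i I)
  then show ?case by (simp add: step_approximable_add)
qed (use step_approximable_step[of "\<lambda>_. 0"] in auto)

lemma step_approximable_limit:
  assumes f: "f \<in> sq_integrable M" and F: "\<And>n. step_approximable (F n)"
    and lim: "(\<lambda>n. L2norm M (\<lambda>q. f q - F n q)) \<longlonglongrightarrow> 0"
  shows "step_approximable f"
  unfolding step_approximable_def
proof (intro conjI allI impI f)
  fix e :: real assume "e > 0"
  then have "\<forall>\<^sub>F n in sequentially. L2norm M (\<lambda>q. f q - F n q) < e / 2"
    using order_tendstoD(2)[OF lim, of "e / 2"] by simp
  then obtain n where n: "L2norm M (\<lambda>q. f q - F n q) < e / 2"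
    by (rule eventually_happens'[OF sequentially_bot, THEN exE])
  obtain N \<phi> where N: "L2norm M (\<lambda>q. F n q - \<phi> (code N q)) < e / 2"
    using F[of n] \<open>e > 0\<close> unfolding step_approximable_def by (meson half_gt_zero)
  have "L2norm M (\<lambda>q. f q - \<phi> (code N q))
      \<le> L2norm M (\<lambda>q. f q - F n q) + L2norm M (\<lambda>q. F n q - \<phi> (code N q))"
    using F[of n] by (intro L2norm_diff_triangle f step_sq_integrable) (simp add: step_approximable_def)
  then show "\<exists>N \<phi>. L2norm M (\<lambda>q. f q - \<phi> (code N q)) < e"
    using n N by (intro exI[of _ N] exI[of _ \<phi>]) linarith
qed

text \<open>A maximum moves by at most the sum of the changes of its arguments. This closure
  supplies the indicators of finite unions.\<close>

lemma step_approximable_max: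
  assumes "step_approximable f" "step_approximable h"
  shows "step_approximable (\<lambda>q. max (f q) (h q))"
  unfolding step_approximable_def
proof (intro conjI allI impI)
  have fh: "f \<in> sq_integrable M" "h \<in> sq_integrable M"
    using assms by (auto simp: step_approximable_def)
  note [measurable] = sq_integrableD(1)[OF fh(1)] sq_integrableD(1)[OF fh(2)]
  have "(\<lambda>q. \<bar>f q\<bar> + \<bar>h q\<bar>) \<in> sq_integrable M"
    by (intro sq_integrable_add sq_integrable_abs fh)
  then show mx: "(\<lambda>q. max (f q) (h q)) \<in> sq_integrable M"
    by (rule sq_integrable_dominated) auto
  fix e :: real assume "e > 0"
  then obtain N \<phi> N' \<psi> where
    1: "L2norm M (\<lambda>q. f q - \<phi> (code N q)) < e / 2" and 2: "L2norm M (\<lambda>q. h q - \<psi> (code N' q)) < e / 2"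
    using assms unfolding step_approximable_def by (meson half_gt_zero)
  define K where "K = max N N'"
  define \<theta> where "\<theta> c = max (\<phi> (c \<inter> {..<N})) (\<psi> (c \<inter> {..<N'}))" for c
  have \<theta>: "\<theta> (code K q) = max (\<phi> (code N q)) (\<psi> (code N' q))" for q
    using code_mono[of N K] code_mono[of N' K] by (auto simp: \<theta>_def K_def)
  have d: "(\<lambda>q. \<bar>f q - \<phi> (code N q)\<bar>) \<in> sq_integrable M" "(\<lambda>q. \<bar>h q - \<psi> (code N' q)\<bar>) \<in> sq_integrable M"
    by (intro sq_integrable_abs sq_integrable_diff fh step_sq_integrable)+
  have "L2norm M (\<lambda>q. max (f q) (h q) - \<theta> (code K q))
      \<le> L2norm M (\<lambda>q. \<bar>f q - \<phi> (code N q)\<bar> + \<bar>h q - \<psi> (code N' q)\<bar>)"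
    by (intro L2norm_mono sq_integrable_add d sq_integrableD(1)[OF sq_integrable_diff] mx step_sq_integrable)
      (auto simp: \<theta>)
  also have "\<dots> \<le> L2norm M (\<lambda>q. f q - \<phi> (code N q)) + L2norm M (\<lambda>q. h q - \<psi> (code N' q))"
    using L2norm_triangle[OF d] by (simp add: L2norm_def)
  finally show "\<exists>N \<phi>. L2norm M (\<lambda>q. max (f q) (h q) - \<phi> (code N q)) < e"
    using 1 2 by (intro exI[of _ K] exI[of _ \<theta>]) linarith
qed

text \<open>Induction over the generation of the sigma-algebra. A countable union is the limit of
  finite unions, whose indicators are maxima and converge in mean square by dominated
  convergence.\<close>

lemma step_approximable_indicator:
  assumes "A \<in> sets M"
  shows "step_approximable (indicator A)"
proof -
  have "A \<in> sigma_sets (space M) (range B)" using assms sets_generated by simp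
  then show ?thesis
  proof (induction rule: sigma_sets.induct)
    case (Basic A)
    then obtain i where "A = B i" by auto
    \<comment> \<open>Level \<open>Suc i\<close> is the first whose code records membership in
      \<open>B i\<close>.\<close>
    then have "indicator A = (\<lambda>q. indicator {c. i \<in> c} (code (Suc i) q) :: real)"
      by (auto simp: indicator_def code_def)
    then show ?case using step_approximable_step[of "indicator {c. i \<in> c}" "Suc i"] by simp
  next
    case Empty
    then show ?case using step_approximable_step[of "\<lambda>_. 0"] by simp
  next
    case (Compl A)
    have *: "step_approximable (\<lambda>q. 1 + (- 1) * indicator A q)"
      by (intro step_approximable_add step_approximable_scale Compl step_approximable_step[of "\<lambda>_. 1"])
    have A: "A \<in> sets M" using Compl sets_generated by simp
    have **: "indicator (space M - A) \<in> sq_integrable M"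
      using A by (intro indicator_sq_integrable) auto
    \<comment> \<open>Outside \<open>space M\<close> the two functions differ, so they are compared
      only under the integral.\<close>
    have "L2norm M (\<lambda>q. indicator (space M - A) q - (1 + (- 1) * indicator A q)) = L2norm M (\<lambda>_. 0)"
      unfolding L2norm_def
      by (intro arg_cong[where f = sqrt] Bochner_Integration.integral_cong) (auto simp: indicator_def)
    then show ?case
      by (intro step_approximable_limit[OF ** *]) (simp add: L2norm_def)
  next
    case (Union A)
    have A: "A i \<in> sets M" for i using Union sets_generated by simp
    define U where "U n = (\<Union>i<n. A i)" for n
    have U_sets [measurable]: "U n \<in> sets M" for n using A by (auto simp: U_def)
    have U: "step_approximable (indicator (U n))" for n
    proof (induction n)
      case 0
      then show ?case using step_approximable_step[of "\<lambda>_. 0"] by (simp add: U_def)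
    next
      case (Suc n)
      have "step_approximable (\<lambda>q. max (indicator (U n) q) (indicator (A n) q))"
        by (intro step_approximable_max Suc Union.IH)
      moreover have "(\<lambda>q. max (indicator (U n) q) (indicator (A n) q))
          = (indicator (U (Suc n)) :: 'q \<Rightarrow> real)"
        by (auto simp: U_def indicator_def lessThan_Suc fun_eq_iff)
      ultimately show ?case by simp
    qed
    have UN: "(\<Union>i. A i) \<in> sets M" using A by auto
    show ?case
    proof (rule step_approximable_limit[OF indicator_sq_integrable[OF UN] U])
      have "(\<lambda>n. \<integral>q. (indicator (\<Union>i. A i) q - indicator (U n) q)\<^sup>2 \<partial>M) \<longlonglongrightarrow> (\<integral>q. (0 :: real) \<partial>M)"
      proof (rule integral_dominated_convergence[where w = "\<lambda>_. 1"])
        show "AE q in M. (\<lambda>n. (indicator (\<Union>i. A i) q - indicator (U n) q)\<^sup>2) \<longlonglongrightarrow> (0 :: real)"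
        proof (rule AE_I2)
          fix q
          have "(\<lambda>n. indicator (\<Union>i<n. A i) q :: real) \<longlonglongrightarrow> indicator (\<Union>i. A i) q"
            by (rule LIMSEQ_indicator_UN)
          then have "(\<lambda>n. indicator (\<Union>i. A i) q - indicator (\<Union>i<n. A i) q :: real) \<longlonglongrightarrow> 0"
            using tendsto_diff[OF tendsto_const[of "indicator (\<Union>i. A i) q :: real" sequentially]] by fastforce
          from tendsto_power[OF this, of 2]
          show "(\<lambda>n. (indicator (\<Union>i. A i) q - indicator (U n) q)\<^sup>2) \<longlonglongrightarrow> (0 :: real)"
            by (simp add: U_def)
        qed
        show "(\<lambda>q. (indicator (\<Union>i. A i) q - indicator (U n) q)\<^sup>2 :: real) \<in> borel_measurable M" for n
          using UN by measurable
      qed (auto simp: indicator_def)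
      then show "(\<lambda>n. L2norm M (\<lambda>q. indicator (\<Union>i. A i) q - indicator (U n) q)) \<longlonglongrightarrow> 0"
        by (simp add: L2norm_tendsto_0_iff)
    qed
  qed
qed

lemma sq_integrable_step_approximable:
  assumes "f \<in> sq_integrable M"
  shows "step_approximable f"
proof -
  note [measurable] = sq_integrableD(1)[OF assms]
  obtain s where s: "\<And>i. simple_function M (s i)"
    "\<And>x. x \<in> space M \<Longrightarrow> (\<lambda>i. s i x) \<longlonglongrightarrow> f x"
    "\<And>i x. x \<in> space M \<Longrightarrow> dist (s i x) 0 \<le> 2 * dist (f x) 0"
    using borel_measurable_implies_sequence_metric[OF sq_integrableD(1)[OF assms], of 0] by metis
  have [measurable]: "s i \<in> borel_measurable M" for i
    using s(1) by (rule borel_measurable_simple_function)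
  have s_sq: "s i \<in> sq_integrable M" for i
  proof -
    have "integrable M (\<lambda>x. (s i x)\<^sup>2)"
    proof (rule Bochner_Integration.integrable_bound)
      show "integrable M (\<lambda>x. (2 * f x)\<^sup>2)"
        using sq_integrableD(2)[OF assms] by (simp add: power_mult_distrib)
      show "AE x in M. norm ((s i x)\<^sup>2) \<le> norm ((2 * f x)\<^sup>2)"
      proof (rule AE_I2)
        fix x assume "x \<in> space M"
        then have "\<bar>s i x\<bar> \<le> \<bar>2 * f x\<bar>" using s(3)[of x i] by (simp add: abs_mult)
        then show "norm ((s i x)\<^sup>2) \<le> norm ((2 * f x)\<^sup>2)"
          by (simp only: real_norm_def abs_power2 abs_le_square_iff)
      qed
    qed simp
    then show ?thesis by (simp add: sq_integrable_def)
  qed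
  have "step_approximable (s i)" for i
  proof -
    have sets: "s i -` {y} \<inter> space M \<in> sets M" for y
      using s(1) by (auto dest: simple_functionD)
    have appr: "step_approximable (\<lambda>x. \<Sum>y\<in>s i ` space M. y * indicator (s i -` {y} \<inter> space M) x)"
      by (intro step_approximable_sum step_approximable_scale step_approximable_indicator sets)
    have rep: "(\<Sum>y\<in>s i ` space M. y * indicator (s i -` {y} \<inter> space M) x) = s i x" if "x \<in> space M" for x
      using simple_function_indicator_representation_banach[OF s(1) that, of i]
      by (simp only: real_scaleR_def mult.commute)
    have "L2norm M (\<lambda>x. s i x - (\<Sum>y\<in>s i ` space M. y * indicator (s i -` {y} \<inter> space M) x)) = L2norm M (\<lambda>_. 0)"
      unfolding L2norm_def
      by (intro arg_cong[where f = sqrt] Bochner_Integration.integral_cong refl) (simp only: rep diff_self)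
    then show ?thesis
      by (intro step_approximable_limit[OF s_sq appr]) (simp add: L2norm_def)
  qed
  moreover have "(\<lambda>i. \<integral>x. (f x - s i x)\<^sup>2 \<partial>M) \<longlonglongrightarrow> (\<integral>x. 0 \<partial>M)"
  \<comment> \<open>The simple functions are bounded by \<open>2 * \<bar>f x\<bar>\<close>, hence
    their distance to \<open>f\<close> by \<open>3 * \<bar>f x\<bar>\<close>.\<close>
  proof (rule integral_dominated_convergence[where w = "\<lambda>x. (3 * f x)\<^sup>2"])
    show "integrable M (\<lambda>x. (3 * f x)\<^sup>2)"
      using sq_integrableD(2)[OF assms] by (simp add: power_mult_distrib)
    show "AE x in M. (\<lambda>i. (f x - s i x)\<^sup>2) \<longlonglongrightarrow> 0"
    proof (rule AE_I2)
      fix x assume "x \<in> space M"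
      then have "(\<lambda>i. f x - s i x) \<longlonglongrightarrow> f x - f x" by (intro tendsto_diff tendsto_const s(2))
      from tendsto_power[OF this, of 2] show "(\<lambda>i. (f x - s i x)\<^sup>2) \<longlonglongrightarrow> 0" by simp
    qed
    show "AE x in M. norm ((f x - s i x)\<^sup>2) \<le> (3 * f x)\<^sup>2" for i
    proof (rule AE_I2)
      fix x assume "x \<in> space M"
      then have "\<bar>s i x\<bar> \<le> 2 * \<bar>f x\<bar>" using s(3) by simp
      then have "\<bar>f x - s i x\<bar> \<le> \<bar>3 * f x\<bar>" by linarith
      then show "norm ((f x - s i x)\<^sup>2) \<le> (3 * f x)\<^sup>2"
        by (simp only: real_norm_def abs_power2 abs_le_square_iff)
    qed
  qed simp_all
  ultimately show ?thesis
    by (intro step_approximable_limit[OF assms]) (simp_all add: L2norm_tendsto_0_iff)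
qed

text \<open>Mean-square martingale convergence, deduced from density: a step function of level
  \<open>N\<close> is also one of each level \<open>N' \<ge> N\<close>, where the average
  approximates \<open>f\<close> at least as well.\<close>

lemma cond_avg_tendsto:
  assumes "f \<in> sq_integrable M"
  shows "(\<lambda>N. L2norm M (\<lambda>q. f q - cond_avg N f q)) \<longlonglongrightarrow> 0"
proof (rule LIMSEQ_I)
  fix e :: real assume "e > 0"
  then obtain N \<phi> where N: "L2norm M (\<lambda>q. f q - \<phi> (code N q)) < e"
    using sq_integrable_step_approximable[OF assms] unfolding step_approximable_def by blast
  have "L2norm M (\<lambda>q. f q - cond_avg N' f q) < e" if "N \<le> N'" for N'
  proof -
    have "L2norm M (\<lambda>q. f q - cond_avg N' f q) \<le> L2norm M (\<lambda>q. f q - \<phi> (code N' q \<inter> {..<N}))"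
      unfolding L2norm_def
      by (intro real_sqrt_le_mono cond_avg_best[OF assms, where \<phi> = "\<lambda>c. \<phi> (c \<inter> {..<N})"])
    then show ?thesis using N code_mono[OF that] by simp
  qed
  then show "\<exists>no. \<forall>N\<ge>no. norm (L2norm M (\<lambda>q. f q - cond_avg N f q) - 0) < e"
    by auto
qed

end

subsection \<open>Moments and small balls of normal variables\<close>

text \<open>The first bound is uniform in the mean; the second, uniform in \<open>\<sigma>\<close>,
  follows from \<open>t * exp (- (t\<^sup>2 / 2)) \<le> 1\<close> with
  \<open>t = \<bar>x - m\<bar> / \<sigma>\<close>.\<close>

lemma normal_density_le:
  assumes "\<sigma> > 0"
  shows "normal_density m \<sigma> x \<le> 1 / \<sigma>" and "x \<noteq> m \<Longrightarrow> normal_density m \<sigma> x \<le> 1 / \<bar>x - m\<bar>"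
proof -
  define t where "t = \<bar>x - m\<bar> / \<sigma>"
  have "\<sigma> = sqrt (\<sigma>\<^sup>2)" using assms by simp
  also have "\<dots> \<le> sqrt (2 * pi * \<sigma>\<^sup>2)"
    using pi_ge_two assms by (intro real_sqrt_le_mono) (auto simp: field_simps)
  finally have s: "1 / sqrt (2 * pi * \<sigma>\<^sup>2) \<le> 1 / \<sigma>"
    using assms by (intro divide_left_mono) auto
  have e: "exp (- (x - m)\<^sup>2 / (2 * \<sigma>\<^sup>2)) = exp (- (t\<^sup>2 / 2))"
    using assms by (simp add: t_def power_divide field_simps)
  have d: "normal_density m \<sigma> x \<le> 1 / \<sigma> * exp (- (t\<^sup>2 / 2))"
    unfolding normal_density_def e by (rule mult_right_mono[OF s]) simp
  have "exp (- (t\<^sup>2 / 2)) \<le> 1" by simp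
  then have "1 / \<sigma> * exp (- (t\<^sup>2 / 2)) \<le> 1 / \<sigma>"
    using assms by (simp add: mult_le_cancel_left1 divide_right_mono)
  then show "normal_density m \<sigma> x \<le> 1 / \<sigma>" using d by linarith
  assume "x \<noteq> m"
  then have t: "t > 0" using assms by (simp add: t_def)
  have "0 \<le> (t - 1)\<^sup>2" by simp
  then have "t \<le> 1 + t\<^sup>2 / 2" by (simp add: power2_eq_square algebra_simps)
  also have "\<dots> \<le> exp (t\<^sup>2 / 2)" by (rule exp_ge_add_one_self)
  finally have "exp (- (t\<^sup>2 / 2)) \<le> 1 / t"
    using t by (simp add: exp_minus inverse_eq_divide divide_left_mono)
  then have "1 / \<sigma> * exp (- (t\<^sup>2 / 2)) \<le> 1 / \<sigma> * (1 / t)"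
    using assms by (intro mult_left_mono) auto
  also have "\<dots> = 1 / \<bar>x - m\<bar>" using assms by (simp add: t_def)
  finally show "normal_density m \<sigma> x \<le> 1 / \<bar>x - m\<bar>" using d by linarith
qed

context prob_space
begin

text \<open>Splitting off the mean bounds the fourth moment by
  \<open>8 * (3 * \<sigma>^4) + 8 * m^4\<close>, at most \<open>24\<close> times the square of the
  second moment \<open>m\<^sup>2 + \<sigma>\<^sup>2\<close>. The constant is uniform over all normal
  laws.\<close>

lemma normal_distributed_moments:
  assumes D: "distributed M lborel X (normal_density m \<sigma>)" and \<sigma>: "\<sigma> > 0"
  shows "X \<in> sq_integrable M" and "(\<integral>u. (X u)\<^sup>2 \<partial>M) = m\<^sup>2 + \<sigma>\<^sup>2"
    and "(\<lambda>u. (X u)\<^sup>2) \<in> sq_integrable M"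
    and "L2norm M (\<lambda>u. (X u)\<^sup>2) \<le> sqrt 24 * (\<integral>u. (X u)\<^sup>2 \<partial>M)"
proof -
  have X [measurable]: "X \<in> borel_measurable M"
    using distributed_measurable[OF D] by simp
  have int: "integrable M (\<lambda>u. (X u - m) ^ k)" for k
    using integrable_normal_moment[OF \<sigma>, of m k]
    by (subst distributed_integrable[OF D, symmetric, of "\<lambda>x. (x - m) ^ k"]) simp_all
  have eq: "(\<integral>u. (X u - m) ^ k \<partial>M) = (\<integral>x. normal_density m \<sigma> x * (x - m) ^ k \<partial>lborel)" for k
    by (subst distributed_integral[OF D, symmetric, of "\<lambda>x. (x - m) ^ k"]) simp_all
  have m1: "(\<integral>u. (X u - m) \<partial>M) = 0"
    using eq[of 1] integral_normal_moment_odd[OF \<sigma>, of m 0] by simp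
  have m2: "(\<integral>u. (X u - m)\<^sup>2 \<partial>M) = \<sigma>\<^sup>2"
    using eq[of 2] integral_normal_moment_even[OF \<sigma>, of m 1] by (simp add: fact_numeral)
  have m4: "(\<integral>u. (X u - m) ^ 4 \<partial>M) = 3 * \<sigma> ^ 4"
    using eq[of 4] integral_normal_moment_even[OF \<sigma>, of m 2] \<sigma>
    by (simp add: fact_numeral power_divide field_simps)
  have sq: "(\<lambda>u. (X u)\<^sup>2) = (\<lambda>u. (X u - m)\<^sup>2 + 2 * m * (X u - m) + m\<^sup>2)"
    by (auto simp: power2_eq_square algebra_simps)
  have int1: "integrable M (\<lambda>u. X u - m)" using int[of 1] by simp
  then have int2: "integrable M (\<lambda>u. (X u)\<^sup>2)" unfolding sq using int[of 2] by simp
  then show "X \<in> sq_integrable M" by (simp add: sq_integrable_def)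
  show e2: "(\<integral>u. (X u)\<^sup>2 \<partial>M) = m\<^sup>2 + \<sigma>\<^sup>2"
    unfolding sq using int1 int[of 2] m1 m2 prob_space by simp
  have le4: "((X u)\<^sup>2)\<^sup>2 \<le> 8 * (X u - m) ^ 4 + 8 * m ^ 4" for u
  proof -
    have 1: "(a + b)\<^sup>2 \<le> 2 * a\<^sup>2 + 2 * b\<^sup>2" for a b :: real
      using sum_squares_bound[of a b] by (simp add: power2_sum)
    have "(X u)\<^sup>2 \<le> 2 * (X u - m)\<^sup>2 + 2 * m\<^sup>2" using 1[of "X u - m" m] by simp
    then have "((X u)\<^sup>2)\<^sup>2 \<le> (2 * (X u - m)\<^sup>2 + 2 * m\<^sup>2)\<^sup>2" by (intro power_mono) auto
    also have "\<dots> \<le> 2 * (2 * (X u - m)\<^sup>2)\<^sup>2 + 2 * (2 * m\<^sup>2)\<^sup>2" by (rule 1)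
    also have "\<dots> = 8 * (X u - m) ^ 4 + 8 * m ^ 4" by (simp add: power_mult_distrib)
    finally show ?thesis .
  qed
  have i4: "integrable M (\<lambda>u. 8 * (X u - m) ^ 4 + 8 * m ^ 4)" using int[of 4] by simp
  have int4: "integrable M (\<lambda>u. ((X u)\<^sup>2)\<^sup>2)"
  proof (rule Bochner_Integration.integrable_bound[OF i4])
    show "AE u in M. norm (((X u)\<^sup>2)\<^sup>2) \<le> norm (8 * (X u - m) ^ 4 + 8 * m ^ 4)"
    proof (rule AE_I2)
      fix u
      have "0 \<le> ((X u)\<^sup>2)\<^sup>2" by (rule zero_le_power2)
      then show "norm (((X u)\<^sup>2)\<^sup>2) \<le> norm (8 * (X u - m) ^ 4 + 8 * m ^ 4)"
        unfolding real_norm_def using le4[of u] by linarith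
    qed
  qed simp
  then show "(\<lambda>u. (X u)\<^sup>2) \<in> sq_integrable M" by (simp add: sq_integrable_def)
  have "(\<integral>u. ((X u)\<^sup>2)\<^sup>2 \<partial>M) \<le> (\<integral>u. 8 * (X u - m) ^ 4 + 8 * m ^ 4 \<partial>M)"
    by (rule integral_mono[OF int4 i4 le4])
  also have "\<dots> = 24 * \<sigma> ^ 4 + 8 * m ^ 4" using int[of 4] m4 prob_space by simp
  also have "\<dots> \<le> 24 * (m\<^sup>2 + \<sigma>\<^sup>2)\<^sup>2"
    by (simp add: power2_sum algebra_simps)
  finally show "L2norm M (\<lambda>u. (X u)\<^sup>2) \<le> sqrt 24 * (\<integral>u. (X u)\<^sup>2 \<partial>M)"
    unfolding e2 L2norm_def
    by (intro real_le_lsqrt) (auto simp: power_mult_distrib)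
qed

text \<open>The mean is not subtracted in the second moment below: if it is large compared with the
  standard deviation, the density is already small near the origin.\<close>

lemma normal_distributed_small_ball:
  assumes D: "distributed M lborel X (normal_density m \<sigma>)" and \<sigma>: "\<sigma> > 0" and "\<epsilon> \<ge> 0"
  shows "prob {u \<in> space M. \<bar>X u\<bar> \<le> \<epsilon>} * L2norm M X \<le> 8 * \<epsilon>"
proof -
  define \<delta> where "\<delta> = L2norm M X"
  have \<delta>2: "\<delta>\<^sup>2 = m\<^sup>2 + \<sigma>\<^sup>2"
    using normal_distributed_moments(2)[OF D \<sigma>] by (simp add: \<delta>_def L2norm_squared)
  have "\<delta> \<noteq> 0" using \<delta>2 \<sigma> by (auto simp: add_nonneg_eq_0_iff)
  then have \<delta>: "\<delta> > 0" using L2norm_nonneg[of M X] by (simp add: \<delta>_def less_le)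
  have X [measurable]: "X \<in> borel_measurable M"
    using distributed_measurable[OF D] by simp
  show ?thesis
  proof (cases "\<epsilon> \<le> \<delta> / 4")
    \<comment> \<open>Here \<open>\<delta> < 4 * \<epsilon>\<close>, and the trivial bound of the
      probability by \<open>1\<close> suffices.\<close>
    case False
    have "prob {u \<in> space M. \<bar>X u\<bar> \<le> \<epsilon>} * \<delta> \<le> 1 * \<delta>"
      using \<delta> by (intro mult_right_mono prob_le_1) auto
    then show ?thesis using False \<open>\<epsilon> \<ge> 0\<close> by (simp add: \<delta>_def)
  next
    case True
    \<comment> \<open>Either \<open>\<sigma> \<ge> \<delta> / 4\<close>, or most of
      \<open>\<delta>\<close> comes from the mean: then
      \<open>\<bar>m\<bar> \<ge> \<delta> / 2\<close>, and the interval stays at distance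
      \<open>\<delta> / 4\<close> from \<open>m\<close>. Its length \<open>2 * \<epsilon>\<close>
      times \<open>4 / \<delta>\<close> yields the constant \<open>8\<close>.\<close>
    have dens: "normal_density m \<sigma> x \<le> 4 / \<delta>" if "x \<in> {-\<epsilon>..\<epsilon>}" for x
    proof (cases "\<sigma> \<ge> \<delta> / 4")
      case s: True
      have "1 / \<sigma> \<le> 1 / (\<delta> / 4)"
        using s \<sigma> \<delta> by (intro divide_left_mono) auto
      then show ?thesis using normal_density_le(1)[OF \<sigma>, of m x] by simp
    next
      case s: False
      have "\<bar>m\<bar> \<ge> \<delta> / 2"
      proof (rule ccontr)
        assume "\<not> ?thesis"
        then have "\<bar>m\<bar>\<^sup>2 \<le> (\<delta> / 2)\<^sup>2" by (intro power_mono) auto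
        moreover have "\<sigma>\<^sup>2 \<le> (\<delta> / 4)\<^sup>2" using s \<sigma> by (intro power_mono) auto
        ultimately have "\<delta>\<^sup>2 \<le> \<delta>\<^sup>2 / 4 + \<delta>\<^sup>2 / 16" using \<delta>2 by (simp add: power_divide)
        moreover have "\<delta>\<^sup>2 > 0" using \<delta> by simp
        ultimately show False by linarith
      qed
      moreover have "\<bar>x\<bar> \<le> \<epsilon>" using that by auto
      ultimately have xm: "\<bar>x - m\<bar> \<ge> \<delta> / 4" using True by linarith
      then have "x \<noteq> m" using \<delta> by auto
      have "1 / \<bar>x - m\<bar> \<le> 1 / (\<delta> / 4)"
        using xm \<delta> \<open>x \<noteq> m\<close> by (intro divide_left_mono) auto
      then show ?thesis using normal_density_le(2)[OF \<sigma> \<open>x \<noteq> m\<close>] by simp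
    qed
    have "{u \<in> space M. \<bar>X u\<bar> \<le> \<epsilon>} = X -` {-\<epsilon>..\<epsilon>} \<inter> space M" by auto
    then have "emeasure M {u \<in> space M. \<bar>X u\<bar> \<le> \<epsilon>}
        = (\<integral>\<^sup>+x. ennreal (normal_density m \<sigma> x) * indicator {-\<epsilon>..\<epsilon>} x \<partial>lborel)"
      using distributed_emeasure[OF D, of "{-\<epsilon>..\<epsilon>}"] by simp
    also have "\<dots> \<le> (\<integral>\<^sup>+x. ennreal (4 / \<delta>) * indicator {-\<epsilon>..\<epsilon>} x \<partial>lborel)"
      using dens by (intro nn_integral_mono) (auto split: split_indicator intro!: ennreal_leI)
    also have "\<dots> = ennreal (4 / \<delta>) * ennreal (2 * \<epsilon>)"
      using \<open>\<epsilon> \<ge> 0\<close> by (simp add: nn_integral_cmult)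
    also have "\<dots> = ennreal (8 * \<epsilon> / \<delta>)"
      using \<delta> \<open>\<epsilon> \<ge> 0\<close> by (simp add: ennreal_mult[symmetric])
    finally have "prob {u \<in> space M. \<bar>X u\<bar> \<le> \<epsilon>} \<le> 8 * \<epsilon> / \<delta>"
      using \<delta> \<open>\<epsilon> \<ge> 0\<close> by (simp add: emeasure_eq_measure)
    then show ?thesis using \<delta> by (simp add: field_simps \<delta>_def)
  qed
qed

subsection \<open>A Paley--Zygmund bound\<close>

text \<open>Being finite everywhere, \<open>T\<close> exceeds some \<open>k\<close> only on a set
  \<open>A\<close> with \<open>prob A < (1 / (2 * C))\<^sup>2\<close>. By Cauchy-Schwarz and
  \<open>moment\<close>, the part of \<open>expectation (S n)\<close> coming from \<open>A\<close>
  is at most half of it and can be absorbed, leaving \<open>2 * k\<close> for every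
  \<open>n\<close>.\<close>

lemma bounded_expectations_if_small_second_moments:
  assumes S: "\<And>n. S n \<in> sq_integrable M" "\<And>n u. u \<in> space M \<Longrightarrow> 0 \<le> S n u"
    and T: "T \<in> borel_measurable M" "\<And>n u. u \<in> space M \<Longrightarrow> S n u \<le> T u"
    and moment: "\<And>n. L2norm M (S n) \<le> C * expectation (S n)" and "C > 0"
  obtains R where "\<And>n. expectation (S n) \<le> R"
proof -
  note [measurable] = T(1)
  have "(\<lambda>n. prob {u \<in> space M. T u > real n}) \<longlonglongrightarrow> prob (\<Inter>n. {u \<in> space M. T u > real n})"
    by (rule finite_Lim_measure_decseq) (auto simp: decseq_def)
  moreover have "(\<Inter>n. {u \<in> space M. T u > real n}) = {}"
  proof (intro equals0I)
    fix u assume "u \<in> (\<Inter>n. {u \<in> space M. T u > real n})"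
    then have "\<forall>n. real n < T u" by blast
    then show False using reals_Archimedean2[of "T u"] by (meson less_asym)
  qed
  ultimately have "(\<lambda>n. prob {u \<in> space M. T u > real n}) \<longlonglongrightarrow> 0" by simp
  then have "\<forall>\<^sub>F n in sequentially. prob {u \<in> space M. T u > real n} < (1 / (2 * C))\<^sup>2"
    using \<open>C > 0\<close> by (intro order_tendstoD(2)) auto
  then obtain k where k: "prob {u \<in> space M. T u > real k} < (1 / (2 * C))\<^sup>2"
    by (rule eventually_happens'[OF sequentially_bot, THEN exE])
  define A where "A = {u \<in> space M. T u > real k}"
  have A [measurable]: "A \<in> sets M" unfolding A_def by measurable
  have A_sq: "(indicator A :: _ \<Rightarrow> real) \<in> sq_integrable M"
    by (rule sq_integrable_bounded[where B = 1]) (auto simp: indicator_def)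
  have "(\<lambda>u. (indicator A u)\<^sup>2 :: real) = indicator A" by (auto simp: indicator_def)
  then have "L2norm M (indicator A) = sqrt (prob A)"
    using sets.sets_into_space[OF A] by (simp add: L2norm_def Int_absorb2)
  also have "\<dots> \<le> 1 / (2 * C)"
    using k \<open>C > 0\<close> by (intro real_le_lsqrt) (auto simp: A_def)
  finally have A_norm: "L2norm M (indicator A) \<le> 1 / (2 * C)" .
  have "expectation (S n) \<le> 2 * real k" for n
  proof -
    have SA: "integrable M (\<lambda>u. S n u * indicator A u)"
      by (rule integrable_mult_sq[OF S(1) A_sq])
    have "0 \<le> expectation (S n)" using S(2) by (intro integral_nonneg_AE) auto
    have "expectation (S n) \<le> (\<integral>u. real k + S n u * indicator A u \<partial>M)"
    proof (rule integral_mono)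
      show "integrable M (S n)" using S(1) by (rule sq_integrable_integrable)
      show "integrable M (\<lambda>u. real k + S n u * indicator A u)" using SA by simp
      fix u assume "u \<in> space M"
      then show "S n u \<le> real k + S n u * indicator A u"
        using T(2)[of u n] by (auto simp: A_def indicator_def)
    qed
    also have "\<dots> = real k + (\<integral>u. S n u * indicator A u \<partial>M)"
      using SA prob_space by simp
    also have "\<dots> \<le> real k + L2norm M (S n) * L2norm M (indicator A)"
      using abs_integral_mult_le[OF S(1) A_sq, of n] by linarith
    also have "\<dots> \<le> real k + (C * expectation (S n)) * (1 / (2 * C))"
      using moment[of n] A_norm \<open>0 \<le> expectation (S n)\<close> \<open>C > 0\<close>
      by (intro add_left_mono mult_mono) auto
    also have "\<dots> = real k + expectation (S n) / 2" using \<open>C > 0\<close> by simp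
    finally show ?thesis by simp
  qed
  then show ?thesis using that by blast
qed

end

subsection \<open>Gaussian measures on the space of square-integrable functions\<close>

definition pairing :: "'q measure \<Rightarrow> ('q \<Rightarrow> real) \<Rightarrow> ('q \<Rightarrow> real) set \<Rightarrow> real" where
  "pairing M w u = (\<integral>q. rep u q * w q \<partial>M)"

lemma pairing_L2_class:
  assumes "f \<in> sq_integrable M" "w \<in> sq_integrable M"
  shows "pairing M w (L2_class M f) = (\<integral>q. f q * w q \<partial>M)"
proof -
  have [measurable]: "rep (L2_class M f) \<in> borel_measurable M" "f \<in> borel_measurable M" "w \<in> borel_measurable M"
    using assms rep_sq_integrable[OF L2_class_in_L2] by (auto simp: sq_integrable_def)
  show ?thesis
    unfolding pairing_def using AE_rep_L2_class[OF assms(1)]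
    by (intro integral_cong_AE) auto
qed

lemma pairing_diff:
  assumes "w \<in> sq_integrable M" "w' \<in> sq_integrable M" "u \<in> L2 M"
  shows "pairing M (\<lambda>q. w q - w' q) u = pairing M w u - pairing M w' u"
  using integrable_mult_sq[OF rep_sq_integrable[OF assms(3)] assms(1)]
    integrable_mult_sq[OF rep_sq_integrable[OF assms(3)] assms(2)]
  by (simp add: pairing_def right_diff_distrib)

lemma pairing_functional:
  assumes w: "w \<in> sq_integrable M"
  shows "L2_functional M (pairing M w)"
  unfolding L2_functional_def
proof (intro conjI ballI allI)
  show "continuous_map (L2_topology M) euclideanreal (pairing M w)"
    unfolding L2_topology_def
  \<comment> \<open>The added \<open>1\<close> keeps the Lipschitz constant positive even when
    \<open>w\<close> vanishes almost everywhere.\<close>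
  proof (rule continuous_map_metric_topology_realI[where C = "L2norm M w + 1"])
    fix u v assume uv: "u \<in> L2 M" "v \<in> L2 M"
    then have r: "rep u \<in> sq_integrable M" "rep v \<in> sq_integrable M"
      by (auto intro: rep_sq_integrable)
    have "pairing M w u - pairing M w v = (\<integral>q. (rep u q - rep v q) * w q \<partial>M)"
      using integrable_mult_sq[OF r(1) w] integrable_mult_sq[OF r(2) w]
      by (simp add: pairing_def left_diff_distrib)
    then have "\<bar>pairing M w u - pairing M w v\<bar> \<le> L2_dist M u v * L2norm M w"
      using abs_integral_mult_le[OF sq_integrable_diff[OF r] w] by (simp add: L2_dist_eq)
    also have "\<dots> \<le> (L2norm M w + 1) * L2_dist M u v"
      by (simp add: L2_dist_eq algebra_simps)
    finally show "\<bar>pairing M w u - pairing M w v\<bar> \<le> (L2norm M w + 1) * L2_dist M u v" .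
  qed (simp add: add_nonneg_pos)
next
  fix u v assume "u \<in> L2 M" "v \<in> L2 M"
  then have r: "rep u \<in> sq_integrable M" "rep v \<in> sq_integrable M"
    by (auto intro: rep_sq_integrable)
  show "pairing M w (L2_add M u v) = pairing M w u + pairing M w v"
    using pairing_L2_class[OF sq_integrable_add[OF r] w]
      integrable_mult_sq[OF r(1) w] integrable_mult_sq[OF r(2) w]
    by (simp add: L2_add_def pairing_def distrib_right)
next
  fix c u assume "u \<in> L2 M"
  then have "rep u \<in> sq_integrable M" by (rule rep_sq_integrable)
  then show "pairing M w (L2_scale M c u) = c * pairing M w u"
    using pairing_L2_class[OF sq_integrable_scale w, of "rep u" c]
    by (simp add: L2_scale_def pairing_def mult.assoc)
qed

locale gaussian_L2 = countably_generated_prob_space M B + G: prob_space g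
  for M :: "'q measure" and B and g :: "('q \<Rightarrow> real) set measure" +
  assumes gaussian: "nondegenerate_gaussian M g"
begin

lemma sets_g: "sets g = sets (borel_L2 M)"
  using gaussian by (simp add: nondegenerate_gaussian_def)

lemma space_g [simp]: "space g = L2 M"
  using sets_eq_imp_space_eq[OF sets_g] by simp

lemma pairing_zero_AE: "AE q in M. w q = 0 \<Longrightarrow> pairing M w u = 0"
  unfolding pairing_def by (rule integral_eq_zero_AE) (auto elim: eventually_mono)

text \<open>Evaluated at the class of \<open>w\<close> itself, the functional gives the squared norm
  of \<open>w\<close>, so it is nonzero and nondegeneracy of \<open>g\<close> applies.\<close>

lemma pairing_normal:
  assumes w: "w \<in> sq_integrable M" and nz: "\<not> (AE q in M. w q = 0)"
  obtains m \<sigma> where "\<sigma> > 0" "distributed g lborel (pairing M w) (normal_density m \<sigma>)"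
proof -
  have "pairing M w (L2_class M w) = (\<integral>q. (w q)\<^sup>2 \<partial>M)"
    using pairing_L2_class[OF w w] by (simp add: power2_eq_square)
  moreover have "(\<integral>q. (w q)\<^sup>2 \<partial>M) \<noteq> 0"
    using integral_nonneg_eq_0_iff_AE[OF sq_integrableD(2)[OF w]] nz by simp
  ultimately have "\<exists>u\<in>L2 M. pairing M w u \<noteq> 0"
    using L2_class_in_L2[OF w] by force
  then show ?thesis
    using gaussian pairing_functional[OF w] that unfolding nondegenerate_gaussian_def by blast
qed

text \<open>Weights of null cells vanish, and a zero functional has no normal density. Treating that
  case separately gives estimates valid for all weights.\<close>

lemma pairing_moments:
  assumes "w \<in> sq_integrable M"
  shows "pairing M w \<in> sq_integrable g" "(\<lambda>u. (pairing M w u)\<^sup>2) \<in> sq_integrable g"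
    and "L2norm g (\<lambda>u. (pairing M w u)\<^sup>2) \<le> sqrt 24 * (\<integral>u. (pairing M w u)\<^sup>2 \<partial>g)"
proof -
  have "pairing M w \<in> sq_integrable g \<and> (\<lambda>u. (pairing M w u)\<^sup>2) \<in> sq_integrable g
      \<and> L2norm g (\<lambda>u. (pairing M w u)\<^sup>2) \<le> sqrt 24 * (\<integral>u. (pairing M w u)\<^sup>2 \<partial>g)"
  proof (cases "AE q in M. w q = 0")
    case True
    then have "pairing M w = (\<lambda>_. 0)" using pairing_zero_AE by blast
    then show ?thesis by (simp add: sq_integrable_def L2norm_def)
  next
    case False
    then obtain m \<sigma> where "\<sigma> > 0" "distributed g lborel (pairing M w) (normal_density m \<sigma>)"
      using pairing_normal[OF assms] by blast
    then show ?thesis using G.normal_distributed_moments by blast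
  qed
  then show "pairing M w \<in> sq_integrable g" "(\<lambda>u. (pairing M w u)\<^sup>2) \<in> sq_integrable g"
    "L2norm g (\<lambda>u. (pairing M w u)\<^sup>2) \<le> sqrt 24 * (\<integral>u. (pairing M w u)\<^sup>2 \<partial>g)"
    by auto
qed

lemma pairing_small_ball:
  assumes "w \<in> sq_integrable M" "\<epsilon> \<ge> 0"
  shows "G.prob {u \<in> space g. \<bar>pairing M w u\<bar> \<le> \<epsilon>} * L2norm g (pairing M w) \<le> 8 * \<epsilon>"
proof (cases "AE q in M. w q = 0")
  case True
  then have "pairing M w = (\<lambda>_. 0)" using pairing_zero_AE by blast
  then show ?thesis using assms by (simp add: L2norm_def)
next
  case False
  then obtain m \<sigma> where "\<sigma> > 0" "distributed g lborel (pairing M w) (normal_density m \<sigma>)"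
    using pairing_normal[OF assms(1)] by blast
  then show ?thesis using G.normal_distributed_small_ball assms(2) by blast
qed

lemma pairing_nondegenerate:
  assumes "w \<in> sq_integrable M" "L2norm g (pairing M w) = 0"
  shows "AE q in M. w q = 0"
proof (rule ccontr)
  assume "\<not> ?thesis"
  then obtain m \<sigma> where *: "\<sigma> > 0" "distributed g lborel (pairing M w) (normal_density m \<sigma>)"
    using pairing_normal[OF assms(1)] by blast
  then have "(L2norm g (pairing M w))\<^sup>2 = m\<^sup>2 + \<sigma>\<^sup>2"
    using G.normal_distributed_moments(2)[OF *(2,1)] by (simp add: L2norm_squared)
  then show False using assms(2) *(1) by (auto simp: add_nonneg_eq_0_iff)
qed

lemma cond_avg_eq_pairing: "cond_avg N (rep u) q = pairing M (avg_weight N (code N q)) u"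
  by (simp add: cond_avg_def pairing_def)

lemma cond_avg_rep_le:
  assumes "u \<in> L2 M"
  shows "(\<integral>q. (cond_avg N (rep u) q)\<^sup>2 \<partial>M) \<le> (\<integral>q. (rep u q)\<^sup>2 \<partial>M)"
proof -
  have "0 \<le> (\<integral>q. (rep u q - cond_avg N (rep u) q)\<^sup>2 \<partial>M)" by simp
  then show ?thesis using cond_avg_residual[OF rep_sq_integrable[OF assms], of N] by simp
qed

lemma cond_avg_rep_residual_tendsto:
  assumes "u \<in> L2 M"
  shows "(\<lambda>N. \<integral>q. (rep u q - cond_avg N (rep u) q)\<^sup>2 \<partial>M) \<longlonglongrightarrow> 0"
  using cond_avg_tendsto[OF rep_sq_integrable[OF assms]] by (simp add: L2norm_tendsto_0_iff)

lemma cond_avg_rep_norm_tendsto: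
  assumes "u \<in> L2 M"
  shows "(\<lambda>N. \<integral>q. (cond_avg N (rep u) q)\<^sup>2 \<partial>M) \<longlonglongrightarrow> (\<integral>q. (rep u q)\<^sup>2 \<partial>M)"
proof -
  have "(\<lambda>N. (\<integral>q. (rep u q)\<^sup>2 \<partial>M) - (\<integral>q. (rep u q - cond_avg N (rep u) q)\<^sup>2 \<partial>M))
      \<longlonglongrightarrow> (\<integral>q. (rep u q)\<^sup>2 \<partial>M) - 0"
    by (intro tendsto_diff tendsto_const cond_avg_rep_residual_tendsto assms)
  then show ?thesis using cond_avg_residual[OF rep_sq_integrable[OF assms]] by simp
qed

lemma cond_avg_rep_norm_measurable [measurable]:
  "(\<lambda>u. \<integral>q. (cond_avg N (rep u) q)\<^sup>2 \<partial>M) \<in> borel_measurable g"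
proof -
  have [measurable]: "pairing M (avg_weight N c) \<in> borel_measurable g" for c
    using pairing_moments(1)[OF avg_weight_sq_integrable] by (rule sq_integrableD(1))
  show ?thesis
    unfolding integral_cond_avg_squared pairing_def[symmetric] by measurable
qed

text \<open>An arbitrary choice of representatives gives no joint measurability in \<open>u\<close>
  and \<open>q\<close>. The norm is reached instead as a limit of finite sums of squared continuous
  functionals.\<close>

lemma norm_squared_measurable [measurable]:
  "(\<lambda>u. \<integral>q. (rep u q)\<^sup>2 \<partial>M) \<in> borel_measurable g"
  by (rule borel_measurable_LIMSEQ_real[where u = "\<lambda>N u. \<integral>q. (cond_avg N (rep u) q)\<^sup>2 \<partial>M"])
    (simp_all add: cond_avg_rep_norm_tendsto cond_avg_rep_norm_measurable)

text \<open>One-dimensional Gaussian marginals control the fourth moments of the norms of the averages,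
  so those norms cannot have large expectations while converging almost surely.\<close>

lemma integrable_norm_squared: "integrable g (\<lambda>u. \<integral>q. (rep u q)\<^sup>2 \<partial>M)"
proof -
  define S where "S N u = (\<integral>q. (cond_avg N (rep u) q)\<^sup>2 \<partial>M)" for N u
  have S_eq: "S N u = (\<Sum>c\<in>Pow {..<N}. prob (cell N c) * (pairing M (avg_weight N c) u)\<^sup>2)" for N u
    by (simp add: S_def integral_cond_avg_squared pairing_def)
  have sq: "(\<lambda>u. prob (cell N c) * (pairing M (avg_weight N c) u)\<^sup>2) \<in> sq_integrable g" for N c
    by (intro sq_integrable_scale pairing_moments(2) avg_weight_sq_integrable)
  have S_sq: "S N \<in> sq_integrable g" for N
    unfolding S_eq[abs_def] by (intro sq_integrable_sum sq)
  have S_nonneg: "0 \<le> S N u" for N u by (simp add: S_def)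
  have moment: "L2norm g (S N) \<le> sqrt 24 * G.expectation (S N)" for N
  proof -
    \<comment> \<open>Minkowski's inequality reduces the estimate to single cells, whatever the
      dependence between them.\<close>
    have "L2norm g (S N) \<le> (\<Sum>c\<in>Pow {..<N}. L2norm g (\<lambda>u. prob (cell N c) * (pairing M (avg_weight N c) u)\<^sup>2))"
      unfolding S_eq[abs_def] by (intro L2norm_sum_le sq)
    also have "\<dots> = (\<Sum>c\<in>Pow {..<N}. prob (cell N c) * L2norm g (\<lambda>u. (pairing M (avg_weight N c) u)\<^sup>2))"
      by (simp add: L2norm_scale)
    also have "\<dots> \<le> (\<Sum>c\<in>Pow {..<N}. prob (cell N c) * (sqrt 24 * (\<integral>u. (pairing M (avg_weight N c) u)\<^sup>2 \<partial>g)))"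
      by (intro sum_mono mult_left_mono pairing_moments(3) avg_weight_sq_integrable) auto
    also have "\<dots> = sqrt 24 * G.expectation (S N)"
      unfolding S_eq[abs_def] using G.sq_integrable_integrable[OF sq]
      by (subst Bochner_Integration.integral_sum) (simp_all add: sum_distrib_left ac_simps)
    finally show ?thesis .
  qed
  have "S N u \<le> (\<integral>q. (rep u q)\<^sup>2 \<partial>M)" if "u \<in> space g" for N u
    using that by (simp add: S_def cond_avg_rep_le)
  then obtain R where R: "\<And>N. G.expectation (S N) \<le> R"
    by (rule G.bounded_expectations_if_small_second_moments[where S = S and C = "sqrt 24",
          OF S_sq S_nonneg norm_squared_measurable _ moment]) (assumption, simp, iprover)
  show ?thesis
  proof (rule integrableI_bounded)
    have "(\<integral>\<^sup>+u. ennreal (norm (\<integral>q. (rep u q)\<^sup>2 \<partial>M)) \<partial>g) = (\<integral>\<^sup>+u. liminf (\<lambda>N. ennreal (S N u)) \<partial>g)"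
    proof (rule nn_integral_cong)
      fix u assume "u \<in> space g"
      then have "(\<lambda>N. ennreal (S N u)) \<longlonglongrightarrow> ennreal (\<integral>q. (rep u q)\<^sup>2 \<partial>M)"
        unfolding S_def by (intro tendsto_ennrealI cond_avg_rep_norm_tendsto) simp
      then show "ennreal (norm (\<integral>q. (rep u q)\<^sup>2 \<partial>M)) = liminf (\<lambda>N. ennreal (S N u))"
        by (simp add: lim_imp_Liminf)
    qed
    also have "\<dots> \<le> liminf (\<lambda>N. \<integral>\<^sup>+u. ennreal (S N u) \<partial>g)"
      using sq_integrableD(1)[OF S_sq] by (intro nn_integral_liminf) simp
    also have "\<dots> = liminf (\<lambda>N. ennreal (G.expectation (S N)))"
      using S_nonneg by (simp add: nn_integral_eq_integral[OF G.sq_integrable_integrable[OF S_sq]])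
    also have "\<dots> \<le> limsup (\<lambda>N. ennreal (G.expectation (S N)))"
      by (rule Liminf_le_Limsup) simp
    also have "\<dots> \<le> ennreal R"
      by (rule Limsup_bounded) (auto intro!: always_eventually ennreal_leI R)
    also have "\<dots> < \<infinity>" by simp
    finally show "(\<integral>\<^sup>+u. ennreal (norm (\<integral>q. (rep u q)\<^sup>2 \<partial>M)) \<partial>g) < \<infinity>" .
  qed simp
qed

end

subsection \<open>Fields without atoms\<close>

lemma atomless_split:
  assumes "finite_measure M" "atomless M" "C \<in> sets M" "measure M C > 0"
  obtains D where "D \<in> sets M" "D \<subseteq> C" "0 < measure M D" "0 < measure M (C - D)"
proof -
  interpret finite_measure M by fact
  have "\<not> is_atom M C" using assms(2) by (simp add: atomless_def)
  then obtain D where D: "D \<in> sets M" "D \<subseteq> C" "emeasure M D \<noteq> 0" "emeasure M D \<noteq> emeasure M C"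
    using assms(3,4) by (auto simp: is_atom_def emeasure_eq_measure)
  have "measure M D \<noteq> measure M C" "0 < measure M D"
    using D(3,4) by (auto simp: emeasure_eq_measure zero_less_measure_iff)
  moreover have "measure M D \<le> measure M C" using D(2) assms(3) by (rule finite_measure_mono)
  ultimately show ?thesis
    using that[OF D(1,2)] finite_measure_Diff[OF assms(3) D(1,2)] by simp
qed

lemma concentration_distr_nn:
  assumes "prob_space M" and [measurable]: "f \<in> borel_measurable M"
  shows "ennreal (concentration n (distr M borel f))
    = (\<integral>\<^sup>+z. ennreal (tent n (f (fst z) - f (snd z))) \<partial>(M \<Otimes>\<^sub>M M))"
proof -
  interpret prob_space M by fact
  interpret P: pair_prob_space M M ..
  have int: "integrable (M \<Otimes>\<^sub>M M) (\<lambda>z. tent n (f (fst z) - f (snd z)))"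
    by (rule P.integrable_const_bound[where B = 1]) (auto simp: tent_bounds)
  have "concentration n (distr M borel f) = (\<integral>z. tent n (f (fst z) - f (snd z)) \<partial>(M \<Otimes>\<^sub>M M))"
    using P.integral_fst'[OF int] by (simp add: concentration_distr[OF assms(1)])
  then show ?thesis
    using nn_integral_eq_integral[OF int] by (simp add: tent_bounds)
qed

text \<open>Each simple function below \<open>f\<close> pulls back to one below the composition of
  \<open>f\<close> with \<open>T\<close>. As \<open>f\<close> is arbitrary, this covers the squared
  \<open>W2\<close> distance as it stands.\<close>

lemma nn_integral_distr_le:
  assumes "T \<in> measurable M N"
  shows "(\<integral>\<^sup>+y. f y \<partial>distr M N T) \<le> (\<integral>\<^sup>+x. f (T x) \<partial>M)"
  unfolding nn_integral_def[of "distr M N T"]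
proof (rule SUP_least)
  fix s assume "s \<in> {s. simple_function (distr M N T) s \<and> s \<le> f}"
  then have s: "simple_function (distr M N T) s" "s \<le> f" by auto
  then have [measurable]: "s \<in> borel_measurable N"
    using borel_measurable_simple_function[OF s(1)] by simp
  have "integral\<^sup>S (distr M N T) s = (\<integral>\<^sup>+y. s y \<partial>distr M N T)"
    by (rule nn_integral_eq_simple_integral[OF s(1), symmetric])
  also have "\<dots> = (\<integral>\<^sup>+x. s (T x) \<partial>M)"
    using assms by (rule nn_integral_distr) simp
  also have "\<dots> \<le> (\<integral>\<^sup>+x. f (T x) \<partial>M)"
    using s(2) by (intro nn_integral_mono) (auto simp: le_fun_def)
  finally show "integral\<^sup>S (distr M N T) s \<le> (\<integral>\<^sup>+x. f (T x) \<partial>M)" .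
qed

lemma concentration_measurable: "concentration n \<in> borel_measurable borel_P2"
  unfolding borel_measurable_iff_less
  using openin_sets_borel_of[OF openin_concentration_less[of n]]
  by (simp add: borel_P2_def)

section \<open>Mean-square convergence of the averaged field\<close>

context gaussian_L2
begin

lemma pairing_measurable [measurable]:
  "w \<in> sq_integrable M \<Longrightarrow> pairing M w \<in> borel_measurable g"
  using pairing_moments(1) by (rule sq_integrableD(1))

lemma iota_measurable_g: "iota M \<in> measurable g borel_P2"
  using iota_measurable[OF prob_space_axioms] by (simp add: measurable_cong_sets[OF sets_g refl])

text \<open>The average is a finite sum of products of a functional of \<open>u\<close> with a cell
  indicator in \<open>q\<close>; this makes Fubini available for the averages.\<close>

lemma cond_avg_rep_measurable_pair:
  "(\<lambda>z. cond_avg N (rep (snd z)) (fst z)) \<in> borel_measurable (M \<Otimes>\<^sub>M g)"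
proof -
  have [measurable]: "pairing M (avg_weight N c) \<in> borel_measurable g" for c
    by (intro pairing_measurable avg_weight_sq_integrable)
  have "(\<lambda>z. \<Sum>c\<in>Pow {..<N}. pairing M (avg_weight N c) (snd z) * indicator (cell N c) (fst z))
      \<in> borel_measurable (M \<Otimes>\<^sub>M g)"
    by measurable
  moreover have "cond_avg N (rep (snd z)) (fst z)
      = (\<Sum>c\<in>Pow {..<N}. pairing M (avg_weight N c) (snd z) * indicator (cell N c) (fst z))"
    if "z \<in> space (M \<Otimes>\<^sub>M g)" for z
    using that step_sum[of "fst z" "\<lambda>c. pairing M (avg_weight N c) (snd z)" N]
    by (simp add: cond_avg_eq_pairing space_pair_measure mem_Times_iff)
  ultimately show ?thesis by (simp cong: measurable_cong)
qed

definition residual :: "nat \<Rightarrow> real" where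
  "residual N = (\<integral>u. \<integral>q. (rep u q - cond_avg N (rep u) q)\<^sup>2 \<partial>M \<partial>g)"

lemma residual_measurable: "(\<lambda>u. \<integral>q. (rep u q - cond_avg N (rep u) q)\<^sup>2 \<partial>M) \<in> borel_measurable g"
proof -
  have "(\<lambda>u. (\<integral>q. (rep u q)\<^sup>2 \<partial>M) - (\<integral>q. (cond_avg N (rep u) q)\<^sup>2 \<partial>M)) \<in> borel_measurable g"
    by measurable
  then show ?thesis
    by (rule measurable_cong[THEN iffD1, rotated]) (simp add: cond_avg_residual rep_sq_integrable)
qed

lemma residual_le:
  assumes "u \<in> L2 M"
  shows "(\<integral>q. (rep u q - cond_avg N (rep u) q)\<^sup>2 \<partial>M) \<le> (\<integral>q. (rep u q)\<^sup>2 \<partial>M)"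
  using cond_avg_residual[OF rep_sq_integrable[OF assms], of N] by simp

lemma integrable_residual: "integrable g (\<lambda>u. \<integral>q. (rep u q - cond_avg N (rep u) q)\<^sup>2 \<partial>M)"
  using integrable_norm_squared residual_measurable
  by (rule Bochner_Integration.integrable_bound) (auto intro!: AE_I2 residual_le)

text \<open>The squared norm dominates the errors, and its integrability under \<open>g\<close> is
  the second moment already established.\<close>

lemma residual_tendsto: "residual \<longlonglongrightarrow> 0"
proof -
  have "residual \<longlonglongrightarrow> (\<integral>u. 0 \<partial>g)"
    unfolding residual_def[abs_def]
    by (rule integral_dominated_convergence[OF _ residual_measurable integrable_norm_squared])
      (auto intro!: AE_I2 residual_le cond_avg_rep_residual_tendsto)
  then show ?thesis by simp
qed

end

text \<open>A subsequence of levels with geometrically decaying error, so that successive changes of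
  the averages are summable at almost every \<open>q\<close>.\<close>

locale rapid_gaussian_L2 = gaussian_L2 M B g
  for M :: "'q measure" and B and g :: "('q \<Rightarrow> real) set measure" +
  fixes r :: "nat \<Rightarrow> nat"
  assumes r_ge: "k \<le> r k" and r_residual: "residual (r k) \<le> (1 / 4) ^ k"
    and atomless: "atomless M"
begin

definition approx :: "nat \<Rightarrow> 'q \<Rightarrow> ('q \<Rightarrow> real) set \<Rightarrow> real" where
  "approx k q u = cond_avg (r k) (rep u) q"

definition weight :: "nat \<Rightarrow> 'q \<Rightarrow> 'q \<Rightarrow> real" where
  "weight k q = avg_weight (r k) (code (r k) q)"

text \<open>The canonical pseudometric of the random field \<open>q \<mapsto> approx k q\<close>,
  taken without subtracting means, as in the small-ball estimate.\<close>

definition spread :: "nat \<Rightarrow> 'q \<Rightarrow> 'q \<Rightarrow> real" where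
  "spread k q q' = L2norm g (\<lambda>u. approx k q u - approx k q' u)"

definition increment :: "nat \<Rightarrow> 'q \<Rightarrow> real" where
  "increment k q = L2norm g (\<lambda>u. approx (Suc k) q u - approx k q u)"

lemma weight_sq_integrable: "weight k q \<in> sq_integrable M"
  unfolding weight_def by (rule avg_weight_sq_integrable)

lemma approx_eq_pairing: "approx k q = pairing M (weight k q)"
  by (auto simp: approx_def weight_def cond_avg_eq_pairing)

lemma approx_sq_integrable: "approx k q \<in> sq_integrable g"
  unfolding approx_eq_pairing by (intro pairing_moments(1) weight_sq_integrable)

lemma approx_space_sq_integrable: "(\<lambda>q. approx k q u) \<in> sq_integrable M"
  unfolding approx_def by (rule cond_avg_sq_integrable)

lemma approx_measurable [measurable (raw)]:
  assumes "f \<in> measurable N M" "h \<in> measurable N g"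
  shows "(\<lambda>x. approx k (f x) (h x)) \<in> borel_measurable N"
  using measurable_compose[OF measurable_Pair[OF assms] cond_avg_rep_measurable_pair[of "r k"]]
  by (simp add: approx_def)

lemma spread_measurable [measurable (raw)]:
  assumes [measurable]: "f \<in> measurable N M" "h \<in> measurable N M"
  shows "(\<lambda>x. spread k (f x) (h x)) \<in> borel_measurable N"
  unfolding spread_def L2norm_def by measurable

lemma increment_measurable [measurable]: "increment k \<in> borel_measurable M"
  unfolding increment_def[abs_def] L2norm_def by measurable

lemma spread_nonneg: "0 \<le> spread k q q'"
  by (simp add: spread_def)

lemma increment_nonneg: "0 \<le> increment k q"
  by (simp add: increment_def)

lemma spread_Suc_le:
  "\<bar>spread (Suc k) q q' - spread k q q'\<bar> \<le> increment k q + increment k q'"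
proof -
  let ?N = "\<lambda>a b. L2norm g (\<lambda>u. a u - b u)"
  have tri: "?N (\<lambda>u. a u - b u) (\<lambda>u. c u - d u) \<le> ?N a c + ?N b d"
    if "a \<in> sq_integrable g" "b \<in> sq_integrable g" "c \<in> sq_integrable g" "d \<in> sq_integrable g" for a b c d
    using L2norm_triangle[OF sq_integrable_diff[OF that(1,3)] sq_integrable_diff[OF that(4,2)]]
    by (simp add: algebra_simps L2norm_minus_commute[of g d b])
  have rev: "\<bar>L2norm g a - L2norm g b\<bar> \<le> ?N a b"
    if "a \<in> sq_integrable g" "b \<in> sq_integrable g" for a b
    using L2norm_triangle[OF sq_integrable_diff[OF that] that(2)]
      L2norm_triangle[OF sq_integrable_diff[OF that(2,1)] that(1)]
      L2norm_minus_commute[of g a b] by simp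
  show ?thesis
    unfolding spread_def increment_def
    by (intro order_trans[OF rev tri] sq_integrable_diff approx_sq_integrable)
qed

text \<open>By Fubini, the squared norm of \<open>increment k\<close> is the expected squared
  distance between consecutive averages, which two residuals control. Cauchy-Schwarz then passes to
  the first moment.\<close>

lemma nn_integral_increment:
  "(\<integral>\<^sup>+q. ennreal (increment k q) \<partial>M) \<le> ennreal (2 * (1 / 2) ^ k)"
proof -
  interpret P: pair_prob_space M g ..
  define res where "res N u = (\<integral>q. (rep u q - cond_avg N (rep u) q)\<^sup>2 \<partial>M)" for N u
  have int_res: "integrable g (res N)" for N
    unfolding res_def using integrable_residual .
  have res_eq: "residual N = (\<integral>u. res N u \<partial>g)" for N
    by (simp add: residual_def res_def)
  have le: "(\<integral>q. (approx (Suc k) q u - approx k q u)\<^sup>2 \<partial>M) \<le> 2 * res (r (Suc k)) u + 2 * res (r k) u"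
    if "u \<in> L2 M" for u
  proof -
    have u: "rep u \<in> sq_integrable M" using that by (rule rep_sq_integrable)
    have i: "integrable M (\<lambda>q. (rep u q - approx j q u)\<^sup>2)" for j
      by (intro sq_integrableD(2) sq_integrable_diff u approx_space_sq_integrable)
    have "(\<integral>q. (approx (Suc k) q u - approx k q u)\<^sup>2 \<partial>M)
        \<le> (\<integral>q. 2 * (rep u q - approx (Suc k) q u)\<^sup>2 + 2 * (rep u q - approx k q u)\<^sup>2 \<partial>M)"
    proof (rule integral_mono)
      show "integrable M (\<lambda>q. (approx (Suc k) q u - approx k q u)\<^sup>2)"
        by (intro sq_integrableD(2) sq_integrable_diff approx_space_sq_integrable)
      show "integrable M (\<lambda>q. 2 * (rep u q - approx (Suc k) q u)\<^sup>2 + 2 * (rep u q - approx k q u)\<^sup>2)"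
        using i by simp
      fix q
      have "(a - b)\<^sup>2 \<le> 2 * a\<^sup>2 + 2 * b\<^sup>2" for a b :: real
        using zero_le_power2[of "a + b"] by (simp add: power2_eq_square algebra_simps)
      from this[of "rep u q - approx k q u" "rep u q - approx (Suc k) q u"]
      show "(approx (Suc k) q u - approx k q u)\<^sup>2
          \<le> 2 * (rep u q - approx (Suc k) q u)\<^sup>2 + 2 * (rep u q - approx k q u)\<^sup>2"
        by simp
    qed
    also have "\<dots> = 2 * res (r (Suc k)) u + 2 * res (r k) u"
      using i by (simp add: res_def approx_def)
    finally show ?thesis .
  qed
  have incr_sq: "ennreal ((increment k q)\<^sup>2) = (\<integral>\<^sup>+u. ennreal ((approx (Suc k) q u - approx k q u)\<^sup>2) \<partial>g)" for q
    unfolding increment_def L2norm_squared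
    by (rule nn_integral_eq_integral[symmetric])
      (auto intro!: sq_integrableD(2) sq_integrable_diff approx_sq_integrable)
  have "(\<integral>\<^sup>+q. ennreal ((increment k q)\<^sup>2) \<partial>M)
      = (\<integral>\<^sup>+u. \<integral>\<^sup>+q. ennreal ((approx (Suc k) q u - approx k q u)\<^sup>2) \<partial>M \<partial>g)"
    unfolding incr_sq by (rule P.Fubini'[symmetric]) measurable
  also have "\<dots> = (\<integral>\<^sup>+u. ennreal (\<integral>q. (approx (Suc k) q u - approx k q u)\<^sup>2 \<partial>M) \<partial>g)"
    by (intro nn_integral_cong nn_integral_eq_integral sq_integrableD(2) sq_integrable_diff
        approx_space_sq_integrable) simp
  also have "\<dots> \<le> (\<integral>\<^sup>+u. ennreal (2 * res (r (Suc k)) u + 2 * res (r k) u) \<partial>g)"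
    by (intro nn_integral_mono ennreal_leI le) simp
  also have "\<dots> = ennreal (\<integral>u. 2 * res (r (Suc k)) u + 2 * res (r k) u \<partial>g)"
    by (intro nn_integral_eq_integral Bochner_Integration.integrable_add integrable_mult_right int_res)
      (simp add: res_def)
  also have "\<dots> = ennreal (2 * residual (r (Suc k)) + 2 * residual (r k))"
    unfolding res_eq using int_res by simp
  \<comment> \<open>The sum is at most \<open>5/2 * (1/4)^k\<close>; rounding up to \<open>4\<close>
    makes the bound a perfect square.\<close>
  also have "\<dots> \<le> ennreal (4 * (1 / 4) ^ k)"
  proof (rule ennreal_leI)
    have "residual (r (Suc k)) \<le> 1 / 4 * (1 / 4) ^ k" using r_residual[of "Suc k"] by simp
    moreover have "0 \<le> (1 / 4 :: real) ^ k" by simp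
    ultimately show "2 * residual (r (Suc k)) + 2 * residual (r k) \<le> 4 * (1 / 4) ^ k"
      using r_residual[of k] by linarith
  qed
  finally have bound: "(\<integral>\<^sup>+q. ennreal ((increment k q)\<^sup>2) \<partial>M) \<le> ennreal (4 * (1 / 4) ^ k)" .
  have int: "integrable M (\<lambda>q. (increment k q)\<^sup>2)"
    using bound by (intro integrableI_bounded) (auto intro: order_le_less_trans)
  then have sq: "increment k \<in> sq_integrable M" by (simp add: sq_integrable_def)
  have "ennreal ((L2norm M (increment k))\<^sup>2) \<le> ennreal (4 * (1 / 4) ^ k)"
    using bound nn_integral_eq_integral[OF int] by (simp add: L2norm_squared)
  then have "(L2norm M (increment k))\<^sup>2 \<le> 4 * (1 / 4) ^ k" by (simp add: ennreal_le_iff)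
  also have "\<dots> = (2 * (1 / 2) ^ k)\<^sup>2"
  proof -
    have "(1 / 4 :: real) ^ k = ((1 / 2)\<^sup>2) ^ k" by (simp add: power2_eq_square)
    also have "\<dots> = ((1 / 2) ^ k)\<^sup>2" by (simp only: power_mult[symmetric] mult.commute)
    finally show ?thesis by (simp only: power_mult_distrib) simp
  qed
  finally have "L2norm M (increment k) \<le> 2 * (1 / 2) ^ k"
    by (rule power2_le_imp_le) simp
  moreover have "(\<integral>q. increment k q \<partial>M) \<le> L2norm M (increment k)"
    using integral_abs_le_L2norm[OF sq] by (simp add: increment_nonneg)
  ultimately have "(\<integral>q. increment k q \<partial>M) \<le> 2 * (1 / 2) ^ k" by linarith
  then show ?thesis
    by (subst nn_integral_eq_integral[OF sq_integrable_integrable[OF sq]])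
      (auto simp: increment_nonneg intro!: ennreal_leI)
qed

text \<open>The expectations sum to a finite number, so the sum of the increments is almost
  everywhere finite.\<close>

lemma AE_summable_increment: "AE q in M. summable (\<lambda>k. increment k q)"
proof -
  have "(\<integral>\<^sup>+q. (\<Sum>k. ennreal (increment k q)) \<partial>M) = (\<Sum>k. \<integral>\<^sup>+q. ennreal (increment k q) \<partial>M)"
    by (rule nn_integral_suminf) simp
  also have "\<dots> \<le> (\<Sum>k. ennreal (2 * (1 / 2) ^ k))"
    by (intro suminf_le nn_integral_increment) auto
  also have "\<dots> = ennreal (\<Sum>k. 2 * (1 / 2) ^ k)"
    by (intro suminf_ennreal2 summable_mult) (auto intro: summable_geometric)
  also have "\<dots> < \<infinity>" by simp
  finally have "AE q in M. (\<Sum>k. ennreal (increment k q)) \<noteq> \<infinity>"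
    by (intro nn_integral_PInf_AE) auto
  then show ?thesis
    by eventually_elim (auto intro!: summable_suminf_not_top simp: increment_nonneg)
qed

lemma convergent_spread:
  assumes "summable (\<lambda>k. increment k q)" "summable (\<lambda>k. increment k q')"
  shows "convergent (\<lambda>k. spread k q q')"
proof -
  have "summable (\<lambda>k. spread (Suc k) q q' - spread k q q')"
    by (rule summable_comparison_test'[OF summable_add[OF assms], of 0])
      (use spread_Suc_le in simp)
  then have "convergent (\<lambda>m. \<Sum>k<m. spread (Suc k) q q' - spread k q q')"
    by (simp add: summable_iff_convergent)
  then have "convergent (\<lambda>m. spread m q q' - spread 0 q q')"
    by (simp only: sum_lessThan_telescope[of "\<lambda>k. spread k q q'"])
  then show ?thesis
    by (simp add: convergent_diff_const_right_iff)
qed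

lemma approx_residual_tendsto:
  assumes "u \<in> L2 M"
  shows "(\<lambda>k. L2norm M (\<lambda>q. rep u q - approx k q u)) \<longlonglongrightarrow> 0"
proof -
  have "filterlim r at_top sequentially"
    by (rule filterlim_at_top_mono[OF filterlim_ident]) (auto simp: r_ge)
  then show ?thesis
    using filterlim_compose[OF cond_avg_tendsto[OF rep_sq_integrable[OF assms]]]
    by (simp add: approx_def)
qed

text \<open>If the field were almost constant on a set of positive measure, a bounded function of mean
  zero supported there would define a degenerate functional.\<close>

lemma no_indistinguishable_points:
  assumes q0: "q0 \<in> space M"
  shows "AE q in M. \<not> (\<lambda>k. spread k q q0) \<longlonglongrightarrow> 0"
proof (rule ccontr)
  assume contra: "\<not> ?thesis"
  interpret P: pair_prob_space M g ..
  have [measurable]: "(\<lambda>q. spread k q q0) \<in> borel_measurable M" for k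
    using q0 by measurable
  \<comment> \<open>Convergent sequences are bounded, so these sets exhaust the bad set; the bound
    \<open>n\<close> later serves as dominating constant.\<close>
  define C where "C n = {q \<in> space M. (\<forall>k. spread k q q0 \<le> real n) \<and> (\<lambda>k. spread k q q0) \<longlonglongrightarrow> 0}" for n :: nat
  have conv_iff: "(\<lambda>k. spread k q q0) \<longlonglongrightarrow> 0 \<longleftrightarrow>
      convergent (\<lambda>k. spread k q q0) \<and> lim (\<lambda>k. spread k q q0) = 0" for q
    by (auto simp: convergent_LIMSEQ_iff limI convergentI)
  have C_sets [measurable]: "C n \<in> sets M" for n
  proof -
    have "Measurable.pred M (\<lambda>q. convergent (\<lambda>k. spread k q q0))"
      unfolding Cauchy_convergent_iff[symmetric] by measurable
    then have [measurable]: "Measurable.pred M (\<lambda>q. (\<lambda>k. spread k q q0) \<longlonglongrightarrow> 0)"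
      unfolding conv_iff by measurable
    show ?thesis unfolding C_def by measurable
  qed
  have "\<exists>n. prob (C n) \<noteq> 0"
  proof (rule ccontr)
    assume "\<not> ?thesis"
    then have "(\<Union>n. C n) \<in> null_sets M"
      by (intro null_sets_UN) (auto simp: null_sets_def emeasure_eq_measure)
    then have "AE q in M. q \<notin> (\<Union>n. C n)" by (rule AE_not_in)
    moreover have "AE q in M. q \<in> space M" by simp
    ultimately have "AE q in M. \<not> (\<lambda>k. spread k q q0) \<longlonglongrightarrow> 0"
    proof eventually_elim
      case (elim q)
      show ?case
      proof
        assume lim: "(\<lambda>k. spread k q q0) \<longlonglongrightarrow> 0"
        then obtain K where K: "\<And>k. norm (spread k q q0) \<le> K"
          using convergent_imp_Bseq[OF convergentI[OF lim]] unfolding Bseq_def by blast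
        obtain n where "K \<le> real n" using real_arch_simple by blast
        then have "q \<in> C n"
          using K elim lim by (auto simp: C_def abs_le_iff intro: order_trans)
        then show False using elim by blast
      qed
    qed
    then show False using contra by simp
  qed
  then obtain n where "prob (C n) > 0" by (auto simp: zero_less_measure_iff)
  then obtain D where D: "D \<in> sets M" "D \<subseteq> C n" "0 < prob D" "0 < prob (C n - D)"
    using atomless_split[OF finite_measure_axioms atomless C_sets] by blast
  define E where "E = C n - D"
  have [measurable]: "D \<in> sets M" "E \<in> sets M" using D by (auto simp: E_def)
  \<comment> \<open>Weighting each half by the mass of the other gives mean zero.\<close>
  define w where "w q = prob E * indicator D q - prob D * indicator E q" for q
  have [measurable]: "w \<in> borel_measurable M" unfolding w_def[abs_def] by measurable
  have w_abs: "\<bar>w q\<bar> \<le> indicator (C n) q" for q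
    using D(2) prob_le_1[of D] prob_le_1[of E]
    by (auto simp: w_def E_def indicator_def)
  have w_sq: "w \<in> sq_integrable M"
    by (rule sq_integrable_bounded[where B = 1]) (auto intro: order_trans[OF w_abs] simp: indicator_def)
  have w_int: "(\<integral>q. w q \<partial>M) = 0"
  proof -
    have "integrable M (indicator D :: 'q \<Rightarrow> real)" "integrable M (indicator E :: 'q \<Rightarrow> real)"
      by (intro sq_integrable_integrable indicator_sq_integrable; simp)+
    then show ?thesis
      unfolding w_def using sets.sets_into_space[of D M] sets.sets_into_space[of E M]
      by (simp add: Int_absorb2)
  qed
  define I where "I k u = (\<integral>q. approx k q u * w q \<partial>M)" for k u
  have I_meas [measurable]: "I k \<in> borel_measurable g" for k
    unfolding I_def[abs_def] by measurable
  have I_le: "ennreal ((I k u)\<^sup>2) \<le> (\<integral>\<^sup>+q. ennreal ((approx k q u - approx k q0 u)\<^sup>2) * indicator (C n) q \<partial>M)"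
    for k u
  proof -
    define d where "d q = approx k q u - approx k q0 u" for q
    have d_sq: "d \<in> sq_integrable M"
      unfolding d_def
      by (intro sq_integrable_diff approx_space_sq_integrable sq_integrable_bounded[where B = "\<bar>approx k q0 u\<bar>"]) auto
    note [measurable] = sq_integrableD(1)[OF d_sq]
    \<comment> \<open>Because \<open>w\<close> has mean zero, the value at \<open>q0\<close>,
      constant in \<open>q\<close>, may be subtracted for free.\<close>
    have I_eq: "I k u = (\<integral>q. d q * w q \<partial>M)"
      using integrable_mult_sq[OF approx_space_sq_integrable w_sq, of k u]
        sq_integrable_integrable[OF w_sq] w_int
      by (simp add: I_def d_def left_diff_distrib)
    have dw: "\<bar>d q * w q\<bar> \<le> \<bar>d q * indicator (C n) q\<bar>" for q
      using mult_left_mono[OF w_abs[of q], of "\<bar>d q\<bar>"] by (simp add: abs_mult)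
    have dC_sq: "(\<lambda>q. d q * indicator (C n) q) \<in> sq_integrable M"
      by (rule sq_integrable_dominated[OF d_sq]) (auto simp: indicator_def)
    have dw_sq: "(\<lambda>q. d q * w q) \<in> sq_integrable M"
      by (rule sq_integrable_dominated[OF dC_sq _ dw]) simp
    have "\<bar>I k u\<bar> \<le> (\<integral>q. \<bar>d q * w q\<bar> \<partial>M)" unfolding I_eq by (rule integral_abs_bound)
    also have "\<dots> \<le> L2norm M (\<lambda>q. d q * w q)" by (rule integral_abs_le_L2norm[OF dw_sq])
    also have "\<dots> \<le> L2norm M (\<lambda>q. d q * indicator (C n) q)"
      by (rule L2norm_mono[OF dC_sq _ dw]) simp
    finally have "\<bar>I k u\<bar>\<^sup>2 \<le> (L2norm M (\<lambda>q. d q * indicator (C n) q))\<^sup>2"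
      by (intro power_mono) auto
    then have "ennreal ((I k u)\<^sup>2) \<le> ennreal (\<integral>q. (d q * indicator (C n) q)\<^sup>2 \<partial>M)"
      by (intro ennreal_leI) (simp add: L2norm_squared)
    also have "\<dots> = (\<integral>\<^sup>+q. ennreal ((d q * indicator (C n) q)\<^sup>2) \<partial>M)"
      by (rule nn_integral_eq_integral[symmetric, OF sq_integrableD(2)[OF dC_sq]]) simp
    also have "\<dots> = (\<integral>\<^sup>+q. ennreal ((d q)\<^sup>2) * indicator (C n) q \<partial>M)"
      by (intro nn_integral_cong) (auto simp: indicator_def)
    finally show ?thesis by (simp add: d_def)
  qed
  have I_norm: "(\<integral>\<^sup>+u. ennreal ((I k u)\<^sup>2) \<partial>g) \<le> (\<integral>\<^sup>+q. ennreal ((spread k q q0)\<^sup>2) * indicator (C n) q \<partial>M)" for k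
  proof -
    have "(\<integral>\<^sup>+u. ennreal ((I k u)\<^sup>2) \<partial>g)
        \<le> (\<integral>\<^sup>+u. \<integral>\<^sup>+q. ennreal ((approx k q u - approx k q0 u)\<^sup>2) * indicator (C n) q \<partial>M \<partial>g)"
      by (intro nn_integral_mono I_le)
    also have "\<dots> = (\<integral>\<^sup>+q. \<integral>\<^sup>+u. ennreal ((approx k q u - approx k q0 u)\<^sup>2) * indicator (C n) q \<partial>g \<partial>M)"
      using q0 by (intro P.Fubini') measurable
    also have "\<dots> = (\<integral>\<^sup>+q. ennreal ((spread k q q0)\<^sup>2) * indicator (C n) q \<partial>M)"
    proof (rule nn_integral_cong)
      fix q assume "q \<in> space M"
      have sq: "(\<lambda>u. approx k q u - approx k q0 u) \<in> sq_integrable g"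
        by (intro sq_integrable_diff approx_sq_integrable)
      note [measurable] = sq_integrableD(1)[OF sq]
      show "(\<integral>\<^sup>+u. ennreal ((approx k q u - approx k q0 u)\<^sup>2) * indicator (C n) q \<partial>g)
          = ennreal ((spread k q q0)\<^sup>2) * indicator (C n) q"
        unfolding spread_def L2norm_squared
        by (simp add: nn_integral_multc nn_integral_eq_integral[OF sq_integrableD(2)[OF sq]])
    qed
    finally show ?thesis .
  qed
  have "(\<lambda>k. \<integral>\<^sup>+q. ennreal ((spread k q q0)\<^sup>2) * indicator (C n) q \<partial>M) \<longlonglongrightarrow> (\<integral>\<^sup>+q. 0 \<partial>M)"
  proof (rule nn_integral_dominated_convergence[where w = "\<lambda>_. ennreal ((real n)\<^sup>2)"])
    show "AE q in M. ennreal ((spread k q q0)\<^sup>2) * indicator (C n) q \<le> ennreal ((real n)\<^sup>2)" for k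
      by (intro AE_I2) (auto simp: C_def indicator_def intro!: ennreal_leI power_mono spread_nonneg)
    show "AE q in M. (\<lambda>k. ennreal ((spread k q q0)\<^sup>2) * indicator (C n) q) \<longlonglongrightarrow> 0"
    proof (rule AE_I2)
      fix q
      show "(\<lambda>k. ennreal ((spread k q q0)\<^sup>2) * indicator (C n) q) \<longlonglongrightarrow> 0"
      proof (cases "q \<in> C n")
        case True
        then have "(\<lambda>k. (spread k q q0)\<^sup>2) \<longlonglongrightarrow> 0\<^sup>2"
          by (intro tendsto_power) (simp add: C_def)
        then have "(\<lambda>k. ennreal ((spread k q q0)\<^sup>2)) \<longlonglongrightarrow> ennreal 0"
          by (intro tendsto_ennrealI) simp
        then show ?thesis using True by simp
      qed simp
    qed
  qed (auto simp: emeasure_space_1 ennreal_mult_less_top)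
  then have lim: "(\<lambda>k. \<integral>\<^sup>+q. ennreal ((spread k q q0)\<^sup>2) * indicator (C n) q \<partial>M) \<longlonglongrightarrow> 0"
    by simp
  have I_lim: "(\<lambda>k. \<integral>\<^sup>+u. ennreal ((I k u)\<^sup>2) \<partial>g) \<longlonglongrightarrow> 0"
    by (rule tendsto_sandwich[OF _ _ tendsto_const lim]) (auto simp: I_norm)
  \<comment> \<open>For each \<open>u\<close> the values \<open>I k u\<close> converge to the
    pairing with \<open>w\<close>, while their second moments tend to zero; Fatou's lemma makes the
    pairing vanish almost surely.\<close>
  have "(\<integral>\<^sup>+u. ennreal ((pairing M w u)\<^sup>2) \<partial>g) = (\<integral>\<^sup>+u. liminf (\<lambda>k. ennreal ((I k u)\<^sup>2)) \<partial>g)"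
  proof (rule nn_integral_cong)
    fix u assume "u \<in> space g"
    then have u: "u \<in> L2 M" by simp
    have "(\<lambda>k. I k u) \<longlonglongrightarrow> pairing M w u"
    proof (rule Lim_transform2[OF tendsto_const])
      have bound: "\<bar>pairing M w u - I k u\<bar> \<le> L2norm M (\<lambda>q. rep u q - approx k q u) * L2norm M w" for k
        using abs_integral_mult_le[OF sq_integrable_diff[OF rep_sq_integrable[OF u] approx_space_sq_integrable] w_sq, of k u]
          integrable_mult_sq[OF rep_sq_integrable[OF u] w_sq]
          integrable_mult_sq[OF approx_space_sq_integrable w_sq, of k u]
        by (simp add: pairing_def I_def left_diff_distrib)
      show "(\<lambda>k. pairing M w u - I k u) \<longlonglongrightarrow> 0"
        by (rule Lim_null_comparison[OF _ tendsto_mult_left_zero[OF approx_residual_tendsto[OF u], of "L2norm M w"]])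
          (use bound in simp)
    qed
    then have "(\<lambda>k. ennreal ((I k u)\<^sup>2)) \<longlonglongrightarrow> ennreal ((pairing M w u)\<^sup>2)"
      by (intro tendsto_ennrealI tendsto_power)
    then show "ennreal ((pairing M w u)\<^sup>2) = liminf (\<lambda>k. ennreal ((I k u)\<^sup>2))"
      by (rule lim_imp_Liminf[OF sequentially_bot, symmetric])
  qed
  also have "\<dots> \<le> liminf (\<lambda>k. \<integral>\<^sup>+u. ennreal ((I k u)\<^sup>2) \<partial>g)"
    by (rule nn_integral_liminf) simp
  also have "\<dots> = 0" using I_lim by (simp add: lim_imp_Liminf)
  finally have "(L2norm g (pairing M w))\<^sup>2 \<le> 0"
    using nn_integral_eq_integral[OF sq_integrableD(2)[OF pairing_moments(1)[OF w_sq]]]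
    by (simp add: L2norm_squared ennreal_eq_0_iff)
  then have "AE q in M. w q = 0"
    using pairing_nondegenerate[OF w_sq] by simp
  \<comment> \<open>On \<open>D\<close> the function \<open>w\<close> has the positive value
    \<open>prob E\<close>.\<close>
  then have "AE q in M. q \<notin> D"
    by eventually_elim (use D(4) in \<open>auto simp: w_def E_def\<close>)
  then have "prob D = 0"
    by (rule measure_eq_0_null_sets[OF AE_iff_null_sets[OF D(1), THEN iffD2]])
  then show False using D(3) by simp
qed

end

subsection \<open>The expected concentration\<close>

text \<open>This is the minimum of \<open>1\<close> and \<open>8 / (n t)\<close>, written so that it
  is continuous in \<open>t\<close> and equals \<open>1\<close> at \<open>t = 0\<close>.\<close>

definition small_ball_bound :: "nat \<Rightarrow> real \<Rightarrow> real" where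
  "small_ball_bound n t = 1 / max 1 (real n * t / 8)"

lemma small_ball_bound_le_1: "small_ball_bound n t \<le> 1"
  by (simp add: small_ball_bound_def)

lemma tendsto_small_ball_bound:
  "(f \<longlongrightarrow> t) F \<Longrightarrow> ((\<lambda>x. small_ball_bound n (f x)) \<longlongrightarrow> small_ball_bound n t) F"
  unfolding small_ball_bound_def by (intro tendsto_intros) auto

lemma small_ball_bound_tendsto_0:
  assumes "t > 0"
  shows "(\<lambda>n. small_ball_bound n t) \<longlonglongrightarrow> 0"
proof (rule tendsto_sandwich[OF _ _ tendsto_const])
  have "(\<lambda>n. (8 / t) * (1 / real n)) \<longlonglongrightarrow> (8 / t) * 0"
    by (intro tendsto_mult tendsto_const lim_1_over_n)
  then show "(\<lambda>n. (8 / t) * (1 / real n)) \<longlonglongrightarrow> 0" by simp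
  show "\<forall>\<^sub>F n in sequentially. small_ball_bound n t \<le> (8 / t) * (1 / real n)"
  proof (rule eventually_sequentiallyI[of 1])
    fix n :: nat assume "1 \<le> n"
    then have "0 < real n * t / 8" using assms by simp
    then have "1 / max 1 (real n * t / 8) \<le> 1 / (real n * t / 8)"
      by (intro divide_left_mono) auto
    then show "small_ball_bound n t \<le> (8 / t) * (1 / real n)"
      by (simp add: small_ball_bound_def ac_simps)
  qed
  show "\<forall>\<^sub>F n in sequentially. 0 \<le> small_ball_bound n t"
    by (simp add: small_ball_bound_def le_max_iff_disj)
qed

lemma small_ball_bound_measurable [measurable]: "small_ball_bound n \<in> borel_measurable borel"
  unfolding small_ball_bound_def[abs_def] by measurable

context rapid_gaussian_L2
begin

text \<open>The difference of the averages at two points is one pairing, with the difference of the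
  weights, so the small-ball estimate with radius \<open>1/n\<close> applies.\<close>

lemma nn_integral_tent_approx_le:
  "(\<integral>\<^sup>+u. ennreal (tent n (approx k q u - approx k q' u)) \<partial>g) \<le> ennreal (small_ball_bound n (spread k q q'))"
proof -
  define X where "X = pairing M (\<lambda>x. weight k q x - weight k q' x)"
  have w: "(\<lambda>x. weight k q x - weight k q' x) \<in> sq_integrable M"
    by (intro sq_integrable_diff weight_sq_integrable)
  have [measurable]: "X \<in> borel_measurable g" unfolding X_def by (rule pairing_measurable[OF w])
  have X: "approx k q u - approx k q' u = X u" if "u \<in> space g" for u
    using that by (simp add: X_def approx_eq_pairing pairing_diff weight_sq_integrable)
  have spread: "spread k q q' = L2norm g X"
    unfolding spread_def L2norm_def
    by (intro arg_cong[where f = sqrt] Bochner_Integration.integral_cong) (simp_all add: X)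
  define p where "p = G.prob {u \<in> space g. real n * \<bar>X u\<bar> \<le> 1}"
  have p: "0 \<le> p" "p \<le> 1" by (simp_all add: p_def)
  have "p * (real n * spread k q q' / 8) \<le> 1"
  proof (cases "n = 0")
    case False
    then have "{u \<in> space g. real n * \<bar>X u\<bar> \<le> 1} = {u \<in> space g. \<bar>X u\<bar> \<le> 1 / real n}"
      by (simp add: field_simps)
    then have "p * spread k q q' \<le> 8 * (1 / real n)"
      using pairing_small_ball[OF w, of "1 / real n"] by (simp add: p_def spread X_def)
    then have "real n * (p * spread k q q') \<le> real n * (8 * (1 / real n))"
      by (intro mult_left_mono) auto
    then show ?thesis using False by (simp add: ac_simps)
  qed simp
  then have "p * max 1 (real n * spread k q q' / 8) \<le> 1"
    using p by (simp add: max_def)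
  then have p_le: "p \<le> small_ball_bound n (spread k q q')"
    by (simp add: small_ball_bound_def pos_le_divide_eq)
  have "(\<integral>\<^sup>+u. ennreal (tent n (approx k q u - approx k q' u)) \<partial>g)
      \<le> (\<integral>\<^sup>+u. indicator {u \<in> space g. real n * \<bar>X u\<bar> \<le> 1} u \<partial>g)"
  proof (rule nn_integral_mono)
    fix u assume u: "u \<in> space g"
    have "ennreal (tent n (X u)) \<le> ennreal (indicator {y. real n * \<bar>y\<bar> \<le> 1} (X u))"
      by (intro ennreal_leI tent_le_indicator)
    also have "\<dots> = indicator {u \<in> space g. real n * \<bar>X u\<bar> \<le> 1} u"
      using u by (simp add: indicator_def)
    finally show "ennreal (tent n (approx k q u - approx k q' u)) \<le> indicator {u \<in> space g. real n * \<bar>X u\<bar> \<le> 1} u"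
      using u by (simp only: X)
  qed
  also have "\<dots> = emeasure g {u \<in> space g. real n * \<bar>X u\<bar> \<le> 1}"
    by (rule nn_integral_indicator) measurable
  also have "\<dots> = ennreal p"
    unfolding p_def by (rule G.emeasure_eq_measure)
  also have "\<dots> \<le> ennreal (small_ball_bound n (spread k q q'))"
    using p_le by (rule ennreal_leI)
  finally show ?thesis .
qed

definition limit_spread :: "'q \<times> 'q \<Rightarrow> real" where
  "limit_spread z = lim (\<lambda>k. spread k (fst z) (snd z))"

lemma limit_spread_measurable [measurable]: "limit_spread \<in> borel_measurable (M \<Otimes>\<^sub>M M)"
  unfolding limit_spread_def[abs_def] by measurable

text \<open>For almost every fixed \<open>q\<close>, summable increments at \<open>q'\<close> give
  convergence, and almost no \<open>q'\<close> is indistinguishable from \<open>q\<close>.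
  Measurability of the resulting set of pairs turns the iterated statement into one for the product
  measure.\<close>

lemma AE_spread_tendsto:
  "AE z in M \<Otimes>\<^sub>M M. (\<lambda>k. spread k (fst z) (snd z)) \<longlonglongrightarrow> limit_spread z \<and> 0 < limit_spread z"
proof -
  interpret P: pair_prob_space M M ..
  have iff: "(\<lambda>k. spread k (fst z) (snd z)) \<longlonglongrightarrow> limit_spread z \<longleftrightarrow>
      convergent (\<lambda>k. spread k (fst z) (snd z))" for z
    by (simp add: convergent_LIMSEQ_iff limit_spread_def)
  have "Measurable.pred (M \<Otimes>\<^sub>M M) (\<lambda>z. convergent (\<lambda>k. spread k (fst z) (snd z)))"
    unfolding Cauchy_convergent_iff[symmetric] by measurable
  then have sets: "{z \<in> space (M \<Otimes>\<^sub>M M). (\<lambda>k. spread k (fst z) (snd z)) \<longlonglongrightarrow> limit_spread z \<and> 0 < limit_spread z}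
      \<in> sets (M \<Otimes>\<^sub>M M)"
    unfolding iff by measurable
  have "AE q in M. AE q' in M. (\<lambda>k. spread k q q') \<longlonglongrightarrow> limit_spread (q, q') \<and> 0 < limit_spread (q, q')"
    using AE_summable_increment AE_space
  proof eventually_elim
    case (elim q)
    show ?case
      using AE_summable_increment no_indistinguishable_points[OF elim(2)]
    proof eventually_elim
      case (elim q')
      have sym: "spread k q q' = spread k q' q" for k
        unfolding spread_def by (rule L2norm_minus_commute)
      have lim: "(\<lambda>k. spread k q q') \<longlonglongrightarrow> limit_spread (q, q')"
        using convergent_spread[OF \<open>summable (\<lambda>k. increment k q)\<close> elim(1)]
        by (simp add: convergent_LIMSEQ_iff limit_spread_def)
      moreover have "0 \<le> limit_spread (q, q')"
        by (rule LIMSEQ_le_const[OF lim]) (auto simp: spread_nonneg)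
      moreover have "limit_spread (q, q') \<noteq> 0"
        using lim elim(2) by (auto simp: sym)
      ultimately show ?case by simp
    qed
  qed
  then show ?thesis
    using P.AE_pair_measure[OF sets] by simp
qed

text \<open>For averages, Fubini moves the expectation inside and the small-ball bound applies to
  each pair. As \<open>k\<close> grows, Fatou's lemma handles the left side, since
  \<open>concentration n\<close> is Lipschitz in the function, and dominated convergence the right
  side.\<close>

lemma nn_integral_concentration_le:
  "(\<integral>\<^sup>+u. ennreal (concentration n (iota M u)) \<partial>g)
    \<le> (\<integral>\<^sup>+z. ennreal (small_ball_bound n (limit_spread z)) \<partial>(M \<Otimes>\<^sub>M M))"
proof -
  interpret P: pair_prob_space M M ..
  interpret Q: pair_prob_space "M \<Otimes>\<^sub>M M" g ..
  define K where "K k u = concentration n (distr M borel (\<lambda>q. approx k q u))" for k u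
  have K_nn: "ennreal (K k u) = (\<integral>\<^sup>+z. ennreal (tent n (approx k (fst z) u - approx k (snd z) u)) \<partial>(M \<Otimes>\<^sub>M M))"
    for k u
    unfolding K_def
    using concentration_distr_nn[OF prob_space_axioms sq_integrableD(1)[OF approx_space_sq_integrable[of k u]]] .
  have K_meas: "(\<lambda>u. ennreal (K k u)) \<in> borel_measurable g" for k
    unfolding K_nn by measurable
  have K_le: "(\<integral>\<^sup>+u. ennreal (K k u) \<partial>g)
      \<le> (\<integral>\<^sup>+z. ennreal (small_ball_bound n (spread k (fst z) (snd z))) \<partial>(M \<Otimes>\<^sub>M M))" for k
  proof -
    have "(\<integral>\<^sup>+u. ennreal (K k u) \<partial>g)
        = (\<integral>\<^sup>+z. \<integral>\<^sup>+u. ennreal (tent n (approx k (fst z) u - approx k (snd z) u)) \<partial>g \<partial>(M \<Otimes>\<^sub>M M))"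
      unfolding K_nn by (rule Q.Fubini') measurable
    also have "\<dots> \<le> (\<integral>\<^sup>+z. ennreal (small_ball_bound n (spread k (fst z) (snd z))) \<partial>(M \<Otimes>\<^sub>M M))"
      by (intro nn_integral_mono nn_integral_tent_approx_le)
    finally show ?thesis .
  qed
  have lim: "(\<lambda>k. \<integral>\<^sup>+z. ennreal (small_ball_bound n (spread k (fst z) (snd z))) \<partial>(M \<Otimes>\<^sub>M M))
      \<longlonglongrightarrow> (\<integral>\<^sup>+z. ennreal (small_ball_bound n (limit_spread z)) \<partial>(M \<Otimes>\<^sub>M M))"
  proof (rule nn_integral_dominated_convergence[where w = "\<lambda>_. 1"])
    show "AE z in M \<Otimes>\<^sub>M M. ennreal (small_ball_bound n (spread k (fst z) (snd z))) \<le> 1" for k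
      by (simp add: small_ball_bound_le_1)
    show "AE z in M \<Otimes>\<^sub>M M. (\<lambda>k. ennreal (small_ball_bound n (spread k (fst z) (snd z))))
        \<longlonglongrightarrow> ennreal (small_ball_bound n (limit_spread z))"
      using AE_spread_tendsto by eventually_elim (auto intro!: tendsto_ennrealI tendsto_small_ball_bound)
  qed (simp_all add: P.emeasure_space_1)
  have "(\<integral>\<^sup>+u. ennreal (concentration n (iota M u)) \<partial>g) = (\<integral>\<^sup>+u. liminf (\<lambda>k. ennreal (K k u)) \<partial>g)"
  proof (rule nn_integral_cong)
    fix u assume "u \<in> space g"
    then have u: "u \<in> L2 M" by simp
    have "(\<lambda>k. K k u) \<longlonglongrightarrow> concentration n (iota M u)"
    proof (rule Lim_transform2[OF tendsto_const])
      have bound: "\<bar>concentration n (iota M u) - K k u\<bar> \<le> 2 * real n * L2norm M (\<lambda>q. rep u q - approx k q u)" for k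
        unfolding iota_def K_def
        using rep_sq_integrable[OF u] approx_space_sq_integrable[of k u]
        by (intro concentration_distr_Lipschitz prob_space_axioms sq_integrable_diff) (auto dest: sq_integrableD(1))
      show "(\<lambda>k. concentration n (iota M u) - K k u) \<longlonglongrightarrow> 0"
        by (rule Lim_null_comparison[OF _ tendsto_mult_right_zero[OF approx_residual_tendsto[OF u], of "2 * real n"]])
          (use bound in simp)
    qed
    then have "(\<lambda>k. ennreal (K k u)) \<longlonglongrightarrow> ennreal (concentration n (iota M u))"
      by (rule tendsto_ennrealI)
    then show "ennreal (concentration n (iota M u)) = liminf (\<lambda>k. ennreal (K k u))"
      by (rule lim_imp_Liminf[OF sequentially_bot, symmetric])
  qed
  also have "\<dots> \<le> liminf (\<lambda>k. \<integral>\<^sup>+u. ennreal (K k u) \<partial>g)"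
    by (rule nn_integral_liminf[OF K_meas])
  also have "\<dots> \<le> liminf (\<lambda>k. \<integral>\<^sup>+z. ennreal (small_ball_bound n (spread k (fst z) (snd z))) \<partial>(M \<Otimes>\<^sub>M M))"
    by (intro Liminf_mono always_eventually allI K_le)
  also have "\<dots> = (\<integral>\<^sup>+z. ennreal (small_ball_bound n (limit_spread z)) \<partial>(M \<Otimes>\<^sub>M M))"
    by (rule lim_imp_Liminf[OF sequentially_bot lim])
  finally show ?thesis .
qed

text \<open>The limiting spread is almost everywhere positive, so the bound tends to zero with
  growing \<open>n\<close>; by Fatou the lower limit of the concentrations then vanishes almost
  surely.\<close>

lemma AE_concentration_small: "AE u in g. \<forall>j. \<exists>n. concentration n (iota M u) < 1 / real (Suc j)"
proof -
  interpret P: pair_prob_space M M ..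
  have meas [measurable]: "(\<lambda>u. concentration n (iota M u)) \<in> borel_measurable g" for n
    by (rule measurable_compose[OF iota_measurable_g concentration_measurable])
  have "(\<lambda>n. \<integral>\<^sup>+z. ennreal (small_ball_bound n (limit_spread z)) \<partial>(M \<Otimes>\<^sub>M M)) \<longlonglongrightarrow> (\<integral>\<^sup>+z. 0 \<partial>(M \<Otimes>\<^sub>M M))"
  proof (rule nn_integral_dominated_convergence[where w = "\<lambda>_. 1"])
    show "AE z in M \<Otimes>\<^sub>M M. ennreal (small_ball_bound n (limit_spread z)) \<le> 1" for n
      by (simp add: small_ball_bound_le_1)
    show "AE z in M \<Otimes>\<^sub>M M. (\<lambda>n. ennreal (small_ball_bound n (limit_spread z))) \<longlonglongrightarrow> 0"
      using AE_spread_tendsto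
      by eventually_elim (use small_ball_bound_tendsto_0 tendsto_ennrealI in \<open>fastforce simp flip: ennreal_0\<close>)
  qed (simp_all add: P.emeasure_space_1)
  then have lim: "(\<lambda>n. \<integral>\<^sup>+z. ennreal (small_ball_bound n (limit_spread z)) \<partial>(M \<Otimes>\<^sub>M M)) \<longlonglongrightarrow> 0"
    by simp
  have "(\<lambda>n. \<integral>\<^sup>+u. ennreal (concentration n (iota M u)) \<partial>g) \<longlonglongrightarrow> 0"
    by (rule tendsto_sandwich[OF _ _ tendsto_const lim]) (auto simp: nn_integral_concentration_le)
  then have "liminf (\<lambda>n. \<integral>\<^sup>+u. ennreal (concentration n (iota M u)) \<partial>g) = 0"
    by (rule lim_imp_Liminf[OF sequentially_bot])
  then have "(\<integral>\<^sup>+u. liminf (\<lambda>n. ennreal (concentration n (iota M u))) \<partial>g) = 0"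
    using nn_integral_liminf[of "\<lambda>n u. ennreal (concentration n (iota M u))" g] by simp
  then have "AE u in g. liminf (\<lambda>n. ennreal (concentration n (iota M u))) = 0"
    by (subst (asm) nn_integral_0_iff_AE) simp_all
  then show ?thesis
  proof eventually_elim
    case (elim u)
    show ?case
    proof (rule ccontr)
      assume "\<not> ?thesis"
      then obtain j where j: "\<And>n. 1 / real (Suc j) \<le> concentration n (iota M u)"
        by (auto simp: not_less)
      have "ennreal (1 / real (Suc j)) \<le> liminf (\<lambda>n. ennreal (concentration n (iota M u)))"
        by (intro Liminf_bounded always_eventually allI ennreal_leI j)
      then show False using elim by (simp add: ennreal_eq_0_iff)
    qed
  qed
qed

end

section \<open>Transfer to the push-forward of the Gaussian measure\<close>

context gaussian_L2
begin

lemma AE_concentration_small: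
  assumes "atomless M"
  shows "AE u in g. \<forall>j. \<exists>n. concentration n (iota M u) < 1 / real (Suc j)"
proof -
  have "\<exists>N\<ge>k. residual N \<le> (1 / 4) ^ k" for k
  proof -
    have "\<forall>\<^sub>F N in sequentially. residual N < (1 / 4) ^ k"
      using residual_tendsto by (rule order_tendstoD(2)) simp
    then obtain N0 where "\<And>N. N0 \<le> N \<Longrightarrow> residual N < (1 / 4) ^ k"
      by (auto simp: eventually_sequentially)
    \<comment> \<open>The maximum secures both the small residual and
      \<open>k \<le> r k\<close>.\<close>
    then show ?thesis by (intro exI[of _ "max k N0"]) (simp add: less_imp_le)
  qed
  then obtain r where "\<And>k. k \<le> r k \<and> residual (r k) \<le> (1 / 4) ^ k" by metis
  then interpret rapid_gaussian_L2 M B g r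
    using assms by unfold_locales auto
  show ?thesis by (rule AE_concentration_small)
qed

text \<open>The reference measure is the Dirac mass at zero; the law of a function lies within its
  norm of it, and the squared norm is integrable under \<open>g\<close>.\<close>

lemma distr_iota_in_P2P2: "distr g borel_P2 (iota M) \<in> P2P2"
  unfolding P2P2_def
proof (intro CollectI conjI bexI)
  let ?\<nu> = "distr M borel (\<lambda>_. 0)"
  have zero: "(\<lambda>_. 0) \<in> sq_integrable M" by (simp add: sq_integrable_def)
  show "?\<nu> \<in> P2" by (rule distr_in_P2[OF prob_space_axioms zero])
  show "prob_space (distr g borel_P2 (iota M))"
    by (rule G.prob_space_distr[OF iota_measurable_g])
  have "(\<integral>\<^sup>+\<mu>. ennreal ((W2 \<mu> ?\<nu>)\<^sup>2) \<partial>distr g borel_P2 (iota M)) \<le> (\<integral>\<^sup>+u. ennreal ((W2 (iota M u) ?\<nu>)\<^sup>2) \<partial>g)"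
    by (rule nn_integral_distr_le[OF iota_measurable_g])
  also have "\<dots> \<le> (\<integral>\<^sup>+u. ennreal (\<integral>q. (rep u q)\<^sup>2 \<partial>M) \<partial>g)"
  proof (intro nn_integral_mono ennreal_leI)
    fix u assume "u \<in> space g"
    then have u: "rep u \<in> sq_integrable M" by (simp add: rep_sq_integrable)
    have "W2 (iota M u) ?\<nu> \<le> L2norm M (\<lambda>q. rep u q - 0)"
      unfolding iota_def by (intro W2_distr_le sq_integrable_diff u zero sq_integrableD(1)[OF u]) simp
    then have "(W2 (iota M u) ?\<nu>)\<^sup>2 \<le> (L2norm M (rep u))\<^sup>2"
      by (intro power_mono) (simp_all add: W2_def)
    then show "(W2 (iota M u) ?\<nu>)\<^sup>2 \<le> (\<integral>q. (rep u q)\<^sup>2 \<partial>M)"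
      by (simp add: L2norm_squared)
  qed
  also have "\<dots> < \<infinity>"
    using nn_integral_eq_integral[OF integrable_norm_squared] by simp
  finally show "(\<integral>\<^sup>+\<mu>. ennreal ((W2 \<mu> ?\<nu>)\<^sup>2) \<partial>distr g borel_P2 (iota M)) < \<infinity>" .
qed simp

text \<open>Almost sure statements transfer along \<open>distr\<close> for measurable sets, so the
  transfer is made for the concentration criterion, which implies regularity on
  \<open>P2\<close>.\<close>

lemma AE_distr_iota_regular:
  assumes "atomless M"
  shows "AE \<mu> in distr g borel_P2 (iota M). \<mu> \<in> P2_regular"
proof -
  have [measurable]: "concentration n \<in> borel_measurable borel_P2" for n
    by (rule concentration_measurable)
  have sets: "{\<mu> \<in> space borel_P2. \<forall>j. \<exists>n. concentration n \<mu> < 1 / real (Suc j)} \<in> sets borel_P2"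
    by measurable
  have "AE \<mu> in distr g borel_P2 (iota M). \<forall>j. \<exists>n. concentration n \<mu> < 1 / real (Suc j)"
    using AE_concentration_small[OF assms] by (subst AE_distr_iff[OF iota_measurable_g sets])
  then show ?thesis
    using AE_space
  proof eventually_elim
    case (elim \<mu>)
    then show ?case by (intro P2_regularI) auto
  qed
qed

end

theorem theorem6p19:
  fixes M :: "'q measure" and g :: "('q \<Rightarrow> real) set measure"
  assumes "standard_borel M" and "prob_space M" and "atomless M"
    and "nondegenerate_gaussian M g"
  shows "super_G_regular M (distr g borel_P2 (iota M))"
proof -
  obtain B :: "nat \<Rightarrow> 'q set" where B: "sets M = sigma_sets (space M) (range B)"
    using standard_borel_countably_generated[OF assms(1)] .
  interpret M: prob_space M by fact
  interpret G: prob_space g using assms(4) by (simp add: nondegenerate_gaussian_def)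
  interpret gaussian_L2 M B g
    using B assms(4) by unfold_locales
  \<comment> \<open>The value on \<open>B\<close> is the \<open>g\<close>-measure of its preimage,
    and \<open>g\<close> is one of the measures tested by \<open>gaussian_null\<close>.\<close>
  have "emeasure (distr g borel_P2 (iota M)) B = 0"
    if "B \<in> sets borel_P2" "gaussian_null M (iota M -` B \<inter> L2 M)" for B
    using that assms(4) by (simp add: emeasure_distr[OF iota_measurable_g] gaussian_null_def)
  then show ?thesis
    unfolding super_G_regular_def
    using distr_iota_in_P2P2 AE_distr_iota_regular[OF assms(3)] by blast
qed

end
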